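(* Let $G$ be a finite group. If $d(G) > 5/16$, then at least one of the following holds: (i) $G$ is supersolvable; (ii) $G$ is isoclinic to $A_4$; (iii) $G/\mathbf{Z}(G)$ is isoclinic to $A_4$.
   Context: For a finite group $G$, $d(G) := \frac{1}{|G|^2}\,|\{(x,y)\in G\times G \mid xy=yx\}|$ is the commuting probability of $G$; equivalently $d(G)=k(G)/|G|$, where $k(G)$ is the number of conjugacy classes of $G$. $\mathbf{Z}(G)$ denotes the center of $G$, $G'$ the commutator (derived) subgroup, and $A_4$ the alternating group of degree 4. Two groups $G$ and $H$ are isoclinic if there are isomorphisms $\varphi: G/\mathbf{Z}(G)\to H/\mathbf{Z}(H)$ and $\phi: G'\to H'$ such that whenever $\varphi(g_1\mathbf{Z}(G))=h_1\mathbf{Z}(H)$ and $\varphi(g_2\mathbf{Z}(G))=h_2\mathbf{Z}(H)$, one has $\phi([g_1,g_2])=[h_1,h_2]$. *)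

theory Defs
  imports Complex_Main "HOL-Algebra.Elementary_Groups" "HOL-Algebra.Sym_Groups"
begin

definition commuting_probability :: "('a, 'b) monoid_scheme \<Rightarrow> real" where
  "commuting_probability G =
     real (card {(x, y). x \<in> carrier G \<and> y \<in> carrier G \<and> x \<otimes>\<^bsub>G\<^esub> y = y \<otimes>\<^bsub>G\<^esub> x})
       / (real (order G))\<^sup>2"

definition group_center :: "('a, 'b) monoid_scheme \<Rightarrow> 'a set" where
  "group_center G = {z \<in> carrier G. \<forall>x \<in> carrier G. z \<otimes>\<^bsub>G\<^esub> x = x \<otimes>\<^bsub>G\<^esub> z}"

(* The convention [x, y] = x y x^-1 y^-1 is that of the library's derived_set. Isoclinism does not
   depend on it: replacing all g_i, h_i by their inverses gives [x, y] = x^-1 y^-1 x y. *)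
definition commutator :: "('a, 'b) monoid_scheme \<Rightarrow> 'a \<Rightarrow> 'a \<Rightarrow> 'a" where
  "commutator G x y = x \<otimes>\<^bsub>G\<^esub> y \<otimes>\<^bsub>G\<^esub> inv\<^bsub>G\<^esub> x \<otimes>\<^bsub>G\<^esub> inv\<^bsub>G\<^esub> y"

definition derived_subgroup :: "('a, 'b) monoid_scheme \<Rightarrow> ('a, 'b) monoid_scheme" where
  "derived_subgroup G = G \<lparr> carrier := derived G (carrier G) \<rparr>"

definition isoclinic :: "('a, 'b) monoid_scheme \<Rightarrow> ('c, 'd) monoid_scheme \<Rightarrow> bool" where
  "isoclinic G H \<longleftrightarrow>
     (\<exists>\<phi> \<in> iso (G Mod group_center G) (H Mod group_center H).
      \<exists>\<psi> \<in> iso (derived_subgroup G) (derived_subgroup H).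
        \<forall>g1 \<in> carrier G. \<forall>g2 \<in> carrier G. \<forall>h1 \<in> carrier H. \<forall>h2 \<in> carrier H.
          \<phi> (group_center G #>\<^bsub>G\<^esub> g1) = group_center H #>\<^bsub>H\<^esub> h1 \<longrightarrow>
          \<phi> (group_center G #>\<^bsub>G\<^esub> g2) = group_center H #>\<^bsub>H\<^esub> h2 \<longrightarrow>
          \<psi> (commutator G g1 g2) = commutator H h1 h2)"

(* Unlike in a polycyclic series, every term of the series is normal in the whole group. *)
definition supersolvable :: "('a, 'b) monoid_scheme \<Rightarrow> bool" where
  "supersolvable G \<longleftrightarrow>
     (\<exists>(n :: nat) (N :: nat \<Rightarrow> 'a set).
        N 0 = {\<one>\<^bsub>G\<^esub>} \<and> N n = carrier G \<and>
        (\<forall>i \<le> n. N i \<lhd> G) \<and>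
        (\<forall>i < n. N i \<subseteq> N (Suc i) \<and> cyclic_group ((G \<lparr> carrier := N (Suc i) \<rparr>) Mod N i)))"

end

theory Submission
  imports Defs "HOL-Algebra.Group_Action" "HOL-Algebra.Multiplicative_Group"
begin

section \<open>Commuting probability above 5/16\<close>

text \<open>Suppose \<open>G\<close> is not supersolvable, and let \<open>L\<close> be maximal among the normal subgroups that are reached
  from \<open>1\<close> by a \<open>G\<close>-normal series with cyclic factors. The quotient \<open>Q = G / L\<close> is nontrivial, has no
  nontrivial cyclic normal subgroup, and \<open>d(Q) \<ge> d(G) > 5/16\<close>. Every nontrivial conjugacy class
  of \<open>Q\<close> has at least three elements. If all nontrivial classes had at least four elements, then
  \<open>|Q| < 12\<close> and all nontrivial centralizers would have order 2, which is absurd. A class of size three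
  consists of commuting elements \<open>x, y, z\<close> with common centralizer \<open>K\<close>; elements outside \<open>K\<close> have at
  least four conjugates, and counting commuting pairs forces \<open>K = {1, x, y, z}\<close> and \<open>|Q| = 12\<close>, so
  \<open>Q\<close> acts faithfully as \<open>A\<^sub>4\<close> on the four conjugates of an element \<open>t\<close> outside \<open>K\<close>.

  Two further counts of commuting pairs, each using \<open>|C\<^sub>G(g)| \<le> |C\<^sub>Q(gL)| |C\<^sub>L(g)|\<close>, show that \<open>L\<close> is
  central and that the preimage \<open>T\<close> of \<open>K\<close> is abelian. Then \<open>G'\<close> consists of the commutators
  \<open>[t, v]\<close> with \<open>v \<in> T\<close>, so it meets \<open>L\<close> trivially, and \<open>G \<rightarrow> A\<^sub>4\<close> induces an isoclinism.\<close>

subsection \<open>Conjugation and centralizers\<close>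

definition conj_by :: "('a, 'b) monoid_scheme \<Rightarrow> 'a \<Rightarrow> 'a \<Rightarrow> 'a" where
  "conj_by G q x = q \<otimes>\<^bsub>G\<^esub> x \<otimes>\<^bsub>G\<^esub> inv\<^bsub>G\<^esub> q"

definition conj_class :: "('a, 'b) monoid_scheme \<Rightarrow> 'a \<Rightarrow> 'a set" where
  "conj_class G x = (\<lambda>q. conj_by G q x) ` carrier G"

definition centralizer :: "('a, 'b) monoid_scheme \<Rightarrow> 'a \<Rightarrow> 'a set" where
  "centralizer G x = {q \<in> carrier G. q \<otimes>\<^bsub>G\<^esub> x = x \<otimes>\<^bsub>G\<^esub> q}"

text \<open>The numerator of \<open>commuting_probability\<close> as a natural number, so that the
  density hypothesis and all later counts are integer inequalities.\<close>

definition commuting_pairs :: "('a, 'b) monoid_scheme \<Rightarrow> nat" where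
  "commuting_pairs G = (\<Sum>x\<in>carrier G. card (centralizer G x))"

lemma commuting_probability_eq:
  assumes "finite (carrier G)"
  shows "commuting_probability G = real (commuting_pairs G) / (real (order G))\<^sup>2"
proof -
  have "{(x, y). x \<in> carrier G \<and> y \<in> carrier G \<and> x \<otimes>\<^bsub>G\<^esub> y = y \<otimes>\<^bsub>G\<^esub> x}
      = Sigma (carrier G) (centralizer G)"
    by (auto simp: centralizer_def)
  moreover have "card (Sigma (carrier G) (centralizer G)) = commuting_pairs G"
    using assms by (simp add: commuting_pairs_def centralizer_def)
  ultimately show ?thesis
    by (simp add: commuting_probability_def)
qed

lemma centralizer_commute: "x \<in> carrier G \<Longrightarrow> y \<in> centralizer G x \<Longrightarrow> x \<in> centralizer G y"
  by (simp add: centralizer_def)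

context group
begin

lemma conj_by_closed [simp]: "\<lbrakk>q \<in> carrier G; x \<in> carrier G\<rbrakk> \<Longrightarrow> conj_by G q x \<in> carrier G"
  by (simp add: conj_by_def)

lemma conj_by_one [simp]: "q \<in> carrier G \<Longrightarrow> conj_by G q \<one> = \<one>"
  by (simp add: conj_by_def)

lemma conj_by_mult:
  "\<lbrakk>q \<in> carrier G; x \<in> carrier G; y \<in> carrier G\<rbrakk>
    \<Longrightarrow> conj_by G q (x \<otimes> y) = conj_by G q x \<otimes> conj_by G q y"
  by (simp add: conj_by_def m_assoc inv_solve_left)

lemma conj_by_inv:
  "\<lbrakk>q \<in> carrier G; x \<in> carrier G\<rbrakk> \<Longrightarrow> conj_by G q (inv x) = inv (conj_by G q x)"
  by (simp add: conj_by_def m_assoc inv_mult_group)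

lemma conj_by_conj_by:
  "\<lbrakk>p \<in> carrier G; q \<in> carrier G; x \<in> carrier G\<rbrakk>
    \<Longrightarrow> conj_by G p (conj_by G q x) = conj_by G (p \<otimes> q) x"
  by (simp add: conj_by_def m_assoc inv_mult_group)

lemma conj_by_one_left [simp]: "x \<in> carrier G \<Longrightarrow> conj_by G \<one> x = x"
  by (simp add: conj_by_def)

lemma conj_by_cancel:
  "\<lbrakk>q \<in> carrier G; x \<in> carrier G; y \<in> carrier G\<rbrakk> \<Longrightarrow> conj_by G q x = conj_by G q y \<longleftrightarrow> x = y"
  by (simp add: conj_by_def)

lemma conj_by_fixed_iff:
  "\<lbrakk>q \<in> carrier G; x \<in> carrier G\<rbrakk> \<Longrightarrow> conj_by G q x = x \<longleftrightarrow> q \<otimes> x = x \<otimes> q"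
  by (simp add: conj_by_def inv_solve_right')

lemma centralizer_iff:
  "x \<in> carrier G \<Longrightarrow> q \<in> centralizer G x \<longleftrightarrow> q \<in> carrier G \<and> conj_by G q x = x"
  by (auto simp: centralizer_def conj_by_fixed_iff)

lemma conj_class_self: "x \<in> carrier G \<Longrightarrow> x \<in> conj_class G x"
  by (auto simp: conj_class_def intro!: image_eqI[where x = \<one>])

lemma conj_class_subset: "x \<in> carrier G \<Longrightarrow> conj_class G x \<subseteq> carrier G"
  by (auto simp: conj_class_def)

lemma conj_class_closed:
  "\<lbrakk>q \<in> carrier G; x \<in> carrier G; y \<in> conj_class G x\<rbrakk> \<Longrightarrow> conj_by G q y \<in> conj_class G x"
  by (auto simp: conj_class_def conj_by_conj_by)

lemma conj_class_trans:
  assumes "x \<in> carrier G" "y \<in> conj_class G x" "z \<in> conj_class G x"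
  shows "\<exists>q\<in>carrier G. conj_by G q y = z"
proof -
  obtain p q where pq: "p \<in> carrier G" "q \<in> carrier G" "y = conj_by G p x" "z = conj_by G q x"
    using assms by (auto simp: conj_class_def)
  then have "conj_by G (q \<otimes> inv p) y = z"
    using assms by (simp add: conj_by_conj_by m_assoc)
  then show ?thesis
    using pq by blast
qed

lemma centralizer_subset: "centralizer G x \<subseteq> carrier G"
  by (auto simp: centralizer_def)

lemma centralizer_subgroup:
  assumes "x \<in> carrier G" shows "subgroup (centralizer G x) G"
proof (rule subgroupI)
  show "\<And>a. a \<in> centralizer G x \<Longrightarrow> inv a \<in> centralizer G x"
    using assms by (auto simp: centralizer_iff)
      (metis conj_by_conj_by conj_by_one_left inv_closed l_inv)
  show "\<And>a b. \<lbrakk>a \<in> centralizer G x; b \<in> centralizer G x\<rbrakk> \<Longrightarrow> a \<otimes> b \<in> centralizer G x"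
    using assms by (auto simp: centralizer_iff conj_by_conj_by[symmetric])
qed (use assms in \<open>auto simp: centralizer_def\<close>)

lemma card_conj_class_centralizer:
  assumes "x \<in> carrier G"
  shows "card (conj_class G x) * card (centralizer G x) = order G"
proof -
  interpret a: group_action G "carrier G" "\<lambda>g. \<lambda>h\<in>carrier G. g \<otimes> h \<otimes> inv g"
    by (rule action_by_conjugation)
  have "orbit G (\<lambda>g. \<lambda>h\<in>carrier G. g \<otimes> h \<otimes> inv g) x = conj_class G x"
    using assms by (auto simp: orbit_def conj_class_def conj_by_def)
  moreover have "stabilizer G (\<lambda>g. \<lambda>h\<in>carrier G. g \<otimes> h \<otimes> inv g) x = centralizer G x"
    using assms by (auto simp: stabilizer_def centralizer_iff conj_by_def)
  ultimately show ?thesis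
    using a.orbit_stabilizer_theorem[OF assms] by simp
qed

lemma mult_card_centralizer_le:
  assumes "x \<in> carrier G" "m \<le> card (conj_class G x)"
  shows "m * card (centralizer G x) \<le> order G"
  using card_conj_class_centralizer[OF assms(1)] mult_le_mono1[OF assms(2)] by metis

text \<open>For \<open>s\<close> in \<open>B\<close> outside \<open>A\<close> the coset
  \<open>sA\<close> lies in \<open>B\<close>, misses \<open>A\<close> and has as many elements.
  Later counts use this to turn "more than half" into "all".\<close>

lemma two_card_proper_subgroup_le:
  assumes A: "subgroup A G" and B: "subgroup B G" and sub: "A \<subseteq> B" "A \<noteq> B" and fin: "finite B"
  shows "2 * card A \<le> card B"
proof -
  obtain s where s: "s \<in> B" "s \<notin> A"
    using sub by blast
  have c: "s \<in> carrier G" "A \<subseteq> carrier G"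
    using s subgroup.subset[OF A] subgroup.subset[OF B] by auto
  have "A \<inter> (\<lambda>a. s \<otimes> a) ` A = {}"
  proof (rule ccontr)
    assume "A \<inter> (\<lambda>a. s \<otimes> a) ` A \<noteq> {}"
    then obtain a where a: "a \<in> A" "s \<otimes> a \<in> A"
      by blast
    then have "s \<otimes> a \<otimes> inv a \<in> A"
      using A by (simp add: subgroup.m_closed subgroup.m_inv_closed)
    moreover have "a \<in> carrier G"
      using a c by blast
    ultimately show False
      using s c by (simp add: m_assoc)
  qed
  moreover have "(\<lambda>a. s \<otimes> a) ` A \<subseteq> B"
    using s sub B by (auto intro: subgroup.m_closed)
  moreover have "card ((\<lambda>a. s \<otimes> a) ` A) = card A"
    by (rule card_image) (use c in \<open>auto simp: inj_on_def subset_eq\<close>)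
  moreover have "finite A"
    using sub fin finite_subset by blast
  ultimately show ?thesis
    using card_mono[OF fin, of "A \<union> (\<lambda>a. s \<otimes> a) ` A"] sub by (simp add: card_Un_disjoint)
qed

lemma centralizer_self: "x \<in> carrier G \<Longrightarrow> x \<in> centralizer G x"
  by (simp add: centralizer_def)

lemma centralizer_one: "centralizer G \<one> = carrier G"
  by (auto simp: centralizer_def)

end

subsection \<open>Small conjugacy classes\<close>

text \<open>Weaker than having no nontrivial cyclic normal subgroup, where \<open>conj_by G q w\<close> could be any
  power of \<open>w\<close>.\<close>

locale no_inversion_stable = group +
  assumes fin: "finite (carrier G)"
    and triv: "\<And>w. \<lbrakk>w \<in> carrier G; \<And>q. q \<in> carrier G \<Longrightarrow> conj_by G q w \<in> {w, inv w}\<rbrakk> \<Longrightarrow> w = \<one>"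
begin

text \<open>A class of size one makes \<open>x\<close> central. In a class \<open>{x, y}\<close>,
  conjugation by \<open>x\<close> fixes \<open>x\<close> and hence \<open>y\<close>, so
  \<open>x \<otimes> y\<close> is fixed by every conjugation and is trivial by \<open>triv\<close>;
  then \<open>y = inv x\<close>, and \<open>triv\<close> applies to \<open>x\<close> itself.\<close>

lemma card_class_ge3:
  assumes x: "x \<in> carrier G" "x \<noteq> \<one>"
  shows "card (conj_class G x) \<ge> 3"
proof (rule ccontr)
  assume "\<not> ?thesis"
  moreover have f: "finite (conj_class G x)"
    using fin by (simp add: conj_class_def)
  moreover have xx: "x \<in> conj_class G x"
    using x by (simp add: conj_class_self)
  ultimately have "card (conj_class G x - {x}) \<le> 1"
    by auto
  then have "\<exists>y. conj_class G x - {x} \<subseteq> {y}"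
    using f card_le_Suc0_iff_eq[of "conj_class G x - {x}"] by (metis One_nat_def finite_Diff insertCI subsetI)
  then obtain y where sub: "conj_class G x \<subseteq> {x, y}"
    by blast
  show False
  proof (cases "conj_class G x = {x}")
    case True
    then have "x = \<one>"
      using x by (intro triv) (auto simp: conj_class_def)
    then show ?thesis using x by simp
  next
    case False
    then have yx: "y \<in> conj_class G x" "y \<noteq> x" and cl: "conj_class G x = {x, y}"
      using sub xx by auto
    then have y: "y \<in> carrier G"
      using x conj_class_subset by blast
    have perm: "(conj_by G q x = x \<and> conj_by G q y = y) \<or> (conj_by G q x = y \<and> conj_by G q y = x)"
      if "q \<in> carrier G" for q
    proof -
      have "conj_by G q x \<in> {x, y}" "conj_by G q y \<in> {x, y}" "conj_by G q x \<noteq> conj_by G q y"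
        using conj_class_closed[OF that x(1) yx(1)]
          conj_class_closed[OF that x(1) conj_class_self] cl that x y yx(2)
        by (simp_all add: conj_by_cancel)
      then show ?thesis by (metis insertE emptyE)
    qed
    have "conj_by G x x = x"
      using x by (simp add: conj_by_fixed_iff)
    then have "conj_by G x y = y"
      using perm[of x] x yx by auto
    then have com: "x \<otimes> y = y \<otimes> x"
      using conj_by_fixed_iff x y by blast
    have "x \<otimes> y = \<one>"
    proof (rule triv)
      fix q assume q: "q \<in> carrier G"
      show "conj_by G q (x \<otimes> y) \<in> {x \<otimes> y, inv (x \<otimes> y)}"
        using perm[OF q] com q x y by (auto simp: conj_by_mult)
    qed (use x y in auto)
    then have "y = inv x"
      using x y com inv_equality by metis
    then have "x = \<one>"
      using x perm by (intro triv) blast+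
    then show False using x by simp
  qed
qed

lemma class3_commute:
  assumes "x \<in> carrier G" and cl: "conj_class G x = {a, b, c}" and d: "a \<noteq> b" "a \<noteq> c" "b \<noteq> c"
  shows "a \<otimes> b = b \<otimes> a"
proof (rule ccontr)
  assume nc: "a \<otimes> b \<noteq> b \<otimes> a"
  have abc: "a \<in> carrier G" "b \<in> carrier G" "c \<in> carrier G"
    using conj_class_subset[OF assms(1)] cl by auto
  have mem: "conj_by G q a \<in> {a, b, c}" "conj_by G q b \<in> {a, b, c}" "conj_by G q c \<in> {a, b, c}"
    if "q \<in> carrier G" for q
    using conj_class_closed[OF that assms(1)] cl by auto
  have inj: "conj_by G q a \<noteq> conj_by G q b" "conj_by G q a \<noteq> conj_by G q c"
       "conj_by G q b \<noteq> conj_by G q c" if "q \<in> carrier G" for q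
    using that abc d by (auto simp: conj_by_cancel)
  have self: "conj_by G u u = u" if "u \<in> carrier G" for u
    using that by (simp add: conj_by_fixed_iff)
  txt \<open>\<open>a, b, c\<close> permute each other like the transpositions of \<open>S\<^sub>3\<close>, so \<open>a \<otimes> b\<close> is a rotation.\<close>
  have ab: "conj_by G a b = c" and ac: "conj_by G a c = b"
    using mem[of a] inj[of a] self[of a] abc nc conj_by_fixed_iff[of a b] by auto
  have ba: "conj_by G b a = c" and bc: "conj_by G b c = a"
    using mem[of b] inj[of b] self[of b] abc nc conj_by_fixed_iff[of b a] by auto
  have sq: "conj_by G u (v \<otimes> v) = conj_by G u v \<otimes> conj_by G u v" 
    if "u \<in> carrier G" "v \<in> carrier G" for u v
    using that by (simp add: conj_by_mult)
  have fixsq: "conj_by G (v \<otimes> v) w = w \<Longrightarrow> conj_by G w (v \<otimes> v) = v \<otimes> v" 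
    if "w \<in> carrier G" "v \<in> carrier G" for v w
    using that conj_by_fixed_iff[of "v \<otimes> v" w] conj_by_fixed_iff[of w "v \<otimes> v"] by simp
  \<comment> \<open>Conjugating twice by \<open>b\<close> returns \<open>a\<close>, so
    \<open>a\<close> commutes with \<open>b \<otimes> b\<close>; but conjugation by \<open>a\<close>
    carries \<open>b \<otimes> b\<close> to \<open>c \<otimes> c\<close>. The next fact exchanges
    the roles of \<open>a\<close> and \<open>b\<close>.\<close>
  have bb: "b \<otimes> b = c \<otimes> c"
    using fixsq[of a b] sq[of a b] ab ba bc abc conj_by_conj_by[of b b a] by simp
  have aa: "a \<otimes> a = c \<otimes> c"
    using fixsq[of b a] sq[of b a] ba ab ac abc conj_by_conj_by[of a a b] by simp
  have "a \<otimes> a = \<one>"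
  proof (rule triv)
    fix q assume q: "q \<in> carrier G"
    then have "conj_by G q (a \<otimes> a) = conj_by G q a \<otimes> conj_by G q a"
      using abc sq by blast
    then show "conj_by G q (a \<otimes> a) \<in> {a \<otimes> a, inv (a \<otimes> a)}"
      using mem[OF q] aa bb by auto
  qed (use abc in auto)
  then have inv: "inv a = a" "inv b = b" "inv c = c"
    using aa bb abc by (auto intro: inv_equality)
  \<comment> \<open>All six products of two distinct class elements are \<open>a \<otimes> b\<close>
    or \<open>b \<otimes> a\<close>. These are inverse to each other, so conjugation can only fix or
    invert \<open>a \<otimes> b\<close>.\<close>
  have rel: "a \<otimes> b = c \<otimes> a" "b \<otimes> c = a \<otimes> b" "b \<otimes> a = c \<otimes> b" "a \<otimes> c = b \<otimes> a"
    using ab ba bc ac abc by (auto simp: conj_by_def inv_solve_right')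
  have "a \<otimes> b = \<one>"
  proof (rule triv)
    fix q assume q: "q \<in> carrier G"
    have "inv (a \<otimes> b) = b \<otimes> a"
      using inv abc by (simp add: inv_mult_group)
    then show "conj_by G q (a \<otimes> b) \<in> {a \<otimes> b, inv (a \<otimes> b)}"
      using mem[OF q] inj[OF q] q abc rel by (auto simp: conj_by_mult)
  qed (use abc in auto)
  then show False
    using nc inv abc inv_mult_group inv_one by metis
qed


lemma class3_commute':
  assumes x: "x \<in> carrier G" and 3: "card (conj_class G x) = 3"
    and uv: "u \<in> conj_class G x" "v \<in> conj_class G x"
  shows "u \<otimes> v = v \<otimes> u"
proof (cases "u = v")
  case False
  have "finite (conj_class G x)"
    using 3 card.infinite by fastforce
  then have "card (conj_class G x - {u, v}) = 1"
    using 3 uv False by (simp add: card_Diff_subset)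
  then obtain w where w: "conj_class G x - {u, v} = {w}"
    using card_1_singletonE by blast
  then have "conj_class G x = {u, v, w}" "u \<noteq> w" "v \<noteq> w"
    using uv by auto
  then show ?thesis
    using class3_commute[OF x] False by blast
qed simp

text \<open>If \<open>q\<close> fixed the ratio, following the cycle would make all three
  consecutive ratios equal, so each ratio \<open>inv u \<otimes> v\<close> of distinct class
  elements would be \<open>?w\<close> or its inverse. Conjugation maps \<open>?w\<close> to such a
  ratio, so \<open>triv\<close> would give \<open>?w = \<one>\<close>, that is
  \<open>a = b\<close>.\<close>

lemma cycle_ratio_not_fixed:
  assumes "x \<in> carrier G" and cl: "conj_class G x = {a, b, c}" and d: "a \<noteq> b" "a \<noteq> c" "b \<noteq> c"
    and q: "q \<in> carrier G" "conj_by G q a = b" "conj_by G q b = c" "conj_by G q c = a"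
  shows "conj_by G q (inv a \<otimes> b) \<noteq> inv a \<otimes> b" (is "_ \<noteq> ?w")
proof
  assume w: "conj_by G q ?w = ?w"
  have abc: "a \<in> carrier G" "b \<in> carrier G" "c \<in> carrier G"
    using conj_class_subset[OF assms(1)] cl by auto
  have mem: "conj_by G p a \<in> {a, b, c}" "conj_by G p b \<in> {a, b, c}"
    if "p \<in> carrier G" for p
    using conj_class_closed[OF that assms(1)] cl by auto
  have inj: "conj_by G p a \<noteq> conj_by G p b" if "p \<in> carrier G" for p
    using that abc d by (auto simp: conj_by_cancel)
  have e: "inv b \<otimes> c = ?w"
    using w q abc by (simp add: conj_by_mult conj_by_inv)
  then have "conj_by G q (inv b \<otimes> c) = ?w"
    using w by simp
  then have e2: "inv c \<otimes> a = ?w"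
    using q abc by (simp add: conj_by_mult conj_by_inv)
  have e3: "inv c \<otimes> b = inv ?w" "inv a \<otimes> c = inv ?w" "inv b \<otimes> a = inv ?w"
    using arg_cong[OF e, of "m_inv G"] arg_cong[OF e2, of "m_inv G"] abc
    by (simp_all add: inv_mult_group)
  have "?w = \<one>"
  proof (rule triv)
    fix p assume p: "p \<in> carrier G"
    then have "conj_by G p ?w = inv (conj_by G p a) \<otimes> conj_by G p b"
      using abc by (simp add: conj_by_mult conj_by_inv)
    then show "conj_by G p ?w \<in> {?w, inv ?w}"
      using mem[OF p] inj[OF p] e e2 e3 by auto
  qed (use abc in auto)
  then have "a = b"
    using abc by (metis inv_closed inv_equality inv_inv)
  then show False using d by simp
qed

text \<open>Elements \<open>u\<close>, \<open>v\<close> conjugate \<open>q\<close> to the same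
  element only if \<open>inv u \<otimes> v\<close> commutes with \<open>q\<close>, so distinct
  members of \<open>S\<close> yield distinct conjugates.\<close>

lemma card_le_class:
  assumes q: "q \<in> carrier G" and S: "S \<subseteq> carrier G"
    and sep: "\<And>u v. \<lbrakk>u \<in> S; v \<in> S; u \<noteq> v\<rbrakk> \<Longrightarrow> conj_by G q (inv u \<otimes> v) \<noteq> inv u \<otimes> v"
  shows "card S \<le> card (conj_class G q)"
proof (rule card_inj_on_le[where f = "\<lambda>u. conj_by G u q"])
  show "inj_on (\<lambda>u. conj_by G u q) S"
  proof (rule inj_onI, rule ccontr)
    fix u v assume uv: "u \<in> S" "v \<in> S" "conj_by G u q = conj_by G v q" "u \<noteq> v"
    then have c: "u \<in> carrier G" "v \<in> carrier G"
      using S by auto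
    have "conj_by G (inv u \<otimes> v) q = conj_by G (inv u) (conj_by G u q)"
      using uv(3) c q by (simp add: conj_by_conj_by[symmetric])
    also have "\<dots> = q"
      using c q by (simp add: conj_by_conj_by)
    finally have "conj_by G q (inv u \<otimes> v) = inv u \<otimes> v"
      using c q by (simp add: conj_by_fixed_iff)
    then show False using sep uv by blast
  qed
  show "(\<lambda>u. conj_by G u q) ` S \<subseteq> conj_class G q"
    using S by (auto simp: conj_class_def)
  show "finite (conj_class G q)"
    using fin by (simp add: conj_class_def)
qed

text \<open>Apply \<open>card_le_class\<close> to \<open>\<one>\<close>, \<open>a\<close>,
  \<open>b\<close>, \<open>c\<close>: a 3-cycle fixes none of \<open>a\<close>, \<open>b\<close>,
  \<open>c\<close>, and \<open>cycle_ratio_not_fixed\<close> handles their ratios.\<close>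

lemma cycle_class_ge4:
  assumes "x \<in> carrier G" and cl: "conj_class G x = {a, b, c}" and d: "a \<noteq> b" "a \<noteq> c" "b \<noteq> c"
    and q: "q \<in> carrier G" "conj_by G q a = b" "conj_by G q b = c" "conj_by G q c = a"
  shows "card (conj_class G q) \<ge> 4"
proof -
  have abc: "a \<in> carrier G" "b \<in> carrier G" "c \<in> carrier G"
    using conj_class_subset[OF assms(1)] cl by auto
  have one: "a \<noteq> \<one>" "b \<noteq> \<one>" "c \<noteq> \<one>"
    using q d by auto
  have "conj_class G x = {b, c, a}" "conj_class G x = {c, a, b}"
    using cl by auto
  then have r: "conj_by G q (inv a \<otimes> b) \<noteq> inv a \<otimes> b" "conj_by G q (inv b \<otimes> c) \<noteq> inv b \<otimes> c"
    "conj_by G q (inv c \<otimes> a) \<noteq> inv c \<otimes> a"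
    using cycle_ratio_not_fixed[OF assms(1)] cl d q by metis+
  have inv_swap: "conj_by G q (inv v \<otimes> u) \<noteq> inv v \<otimes> u" 
    if "conj_by G q (inv u \<otimes> v) \<noteq> inv u \<otimes> v" "u \<in> carrier G" "v \<in> carrier G" for u v
  proof -
    have "inv (inv u \<otimes> v) = inv v \<otimes> u"
      using that by (simp add: inv_mult_group)
    then show ?thesis
      using that q conj_by_inv[of q "inv u \<otimes> v"] by (metis conj_by_closed inv_closed inv_inv m_closed)
  qed
  have r': "conj_by G q (inv b \<otimes> a) \<noteq> inv b \<otimes> a" "conj_by G q (inv c \<otimes> b) \<noteq> inv c \<otimes> b"
    "conj_by G q (inv a \<otimes> c) \<noteq> inv a \<otimes> c"
    using inv_swap r abc by blast+
  have "card {\<one>, a, b, c} \<le> card (conj_class G q)"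
  proof (rule card_le_class)
    fix u v assume "u \<in> {\<one>, a, b, c}" "v \<in> {\<one>, a, b, c}" "u \<noteq> v"
    then show "conj_by G q (inv u \<otimes> v) \<noteq> inv u \<otimes> v"
      using r r' q abc d by (auto simp: conj_by_inv)
  qed (use q abc in auto)
  then show ?thesis
    using one d by auto
qed

lemma swap_class_ge4:
  assumes x: "x \<in> carrier G" and cl: "conj_class G x = {a, b, c}" and d: "a \<noteq> b" "a \<noteq> c" "b \<noteq> c"
    and q: "q \<in> carrier G" "conj_by G q a = a" "conj_by G q b = c" "conj_by G q c = b"
  shows "card (conj_class G q) \<ge> 4"
proof (rule ccontr)
  assume lt: "\<not> ?thesis"
  have abc: "a \<in> carrier G" "b \<in> carrier G" "c \<in> carrier G"
    using conj_class_subset[OF x] cl by auto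
  have "q \<noteq> \<one>"
    using q d abc by auto
  then have 3: "card (conj_class G q) = 3"
    using card_class_ge3[of q] q lt by simp
  txt \<open>A conjugate of \<open>q\<close> that fixes \<open>b\<close> instead of \<open>a\<close> cannot commute with \<open>q\<close>.\<close>
  obtain h where h: "h \<in> carrier G" "conj_by G h a = b"
    using conj_class_trans[OF x, of a b] cl by auto
  define p where "p = conj_by G h q"
  have p: "p \<in> carrier G" "p \<in> conj_class G q"
    using h q by (auto simp: p_def conj_class_def)
  have com: "q \<otimes> p = p \<otimes> q"
    using class3_commute'[OF q(1) 3 conj_class_self p(2)] q by blast
  have ph: "conj_by G p (conj_by G h v) = conj_by G h (conj_by G q v)" if "v \<in> carrier G" for v
  proof -
    have "p \<otimes> h = h \<otimes> q"
      using h q by (simp add: p_def conj_by_def m_assoc)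
    then show ?thesis
      using that h q p by (simp add: conj_by_conj_by)
  qed
  have pb: "conj_by G p b = b"
    using ph[of a] h q abc by simp
  \<comment> \<open>Commuting with \<open>q\<close>, the element \<open>p\<close> also fixes the
    image \<open>c\<close> of \<open>b\<close>, hence the whole class. Transported back by
    \<open>h\<close>, this makes \<open>q\<close> fix \<open>b\<close>.\<close>
  have "conj_by G p (conj_by G q b) = conj_by G q (conj_by G p b)"
    using com q(1) p abc by (simp add: conj_by_conj_by)
  then have pc: "conj_by G p c = c"
    using pb q by simp
  have "conj_by G p a \<in> {a, b, c}"
    using conj_class_closed[OF p(1) x] cl by auto
  then have pa: "conj_by G p a = a"
    using pb pc conj_by_cancel[of p a b] conj_by_cancel[of p a c] p abc d by auto
  have "conj_by G h b \<in> {a, b, c}"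
    using conj_class_closed[OF h(1) x] cl by auto
  then have "conj_by G p (conj_by G h b) = conj_by G h b"
    using pa pb pc by auto
  then have "conj_by G h (conj_by G q b) = conj_by G h b"
    using ph abc by simp
  then have "c = b"
    using h q abc by (simp add: conj_by_cancel)
  then show False using d by simp
qed

end

subsection \<open>Reduction to order twelve\<close>

text \<open>What the counting yields about the quotient, with \<open>K\<close> in the role of the
  Klein four-group. The bound \<open>centralizer_out\<close> is sharpened to equality within
  \<open>outside_K\<close>, and \<open>iso_alt_group_4\<close> identifies the group.\<close>

locale a4_like = group +
  fixes K
  assumes normal_K: "normal K G"
    and order_12: "order G = 12"
    and card_K: "card K = 4"
    and centralizer_in: "\<And>k. \<lbrakk>k \<in> K; k \<noteq> \<one>\<rbrakk> \<Longrightarrow> centralizer G k = K"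
    and centralizer_out: "\<And>g. \<lbrakk>g \<in> carrier G; g \<notin> K\<rbrakk> \<Longrightarrow> card (centralizer G g) \<le> 3"

context no_inversion_stable
begin

lemma exists_class3:
  assumes d: "5 * (order G)\<^sup>2 < 16 * commuting_pairs G" and nt: "order G \<noteq> 1"
  shows "\<exists>x\<in>carrier G. card (conj_class G x) = 3"
proof (rule ccontr)
  assume no: "\<not> ?thesis"
  have pos: "order G > 0"
    using fin order_gt_0_iff_finite by blast
  have le: "4 * card (centralizer G x) \<le> order G" if "x \<in> carrier G" "x \<noteq> \<one>" for x
  proof -
    have "card (conj_class G x) \<noteq> 3"
      using no that by blast
    then have "card (conj_class G x) \<ge> 4"
      using card_class_ge3[OF that] by simp
    then show ?thesis
      using mult_card_centralizer_le[OF that(1)] by simp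
  qed
  have "4 * commuting_pairs G = (\<Sum>x\<in>carrier G. 4 * card (centralizer G x))"
    by (simp add: commuting_pairs_def sum_distrib_left)
  also have "\<dots> = 4 * order G + (\<Sum>x\<in>carrier G - {\<one>}. 4 * card (centralizer G x))"
    using fin by (subst sum.remove[of _ \<one>]) (auto simp: centralizer_one order_def)
  also have "(\<Sum>x\<in>carrier G - {\<one>}. 4 * card (centralizer G x)) \<le> (\<Sum>x\<in>carrier G - {\<one>}. order G)"
    by (rule sum_mono) (use le in auto)
  also have "(\<Sum>x\<in>carrier G - {\<one>}. order G) = (order G - 1) * order G"
    using fin by (simp add: order_def)
  finally have "4 * commuting_pairs G \<le> 4 * order G + (order G - 1) * order G"
    by simp
  then have "5 * (order G)\<^sup>2 < 4 * (4 * order G + (order G - 1) * order G)"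
    using d by simp
  \<comment> \<open>With \<open>n = order G\<close> this is
    \<open>5n^2 < 4n^2 + 12n\<close>.\<close>
  then have "order G * (5 * order G) < order G * (12 + 4 * order G)"
    using pos by (simp add: power2_eq_square algebra_simps diff_mult_distrib)
  then have small: "order G < 12"
    using pos by simp
  have cen: "centralizer G x = {\<one>, x}" if x: "x \<in> carrier G" "x \<noteq> \<one>" for x
  proof -
    have "{\<one>, x} \<subseteq> centralizer G x"
      using x by (simp add: centralizer_def)
    moreover have "card (centralizer G x) \<le> card {\<one>, x}"
      using le[OF x] small x by simp
    moreover have "finite (centralizer G x)"
      using fin centralizer_subset by (rule rev_finite_subset)
    ultimately show ?thesis
      using card_seteq by blast
  qed
  \<comment> \<open>\<open>x \<otimes> x\<close> lies in \<open>{\<one>, x}\<close> and is not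
    \<open>x\<close>. A group of exponent two is abelian, so \<open>triv\<close> makes every element
    trivial.\<close>
  have sq: "x \<otimes> x = \<one>" if x: "x \<in> carrier G" for x
  proof (cases "x = \<one>")
    case False
    have "x \<otimes> x \<in> centralizer G x"
      using x by (simp add: centralizer_def m_assoc)
    then show ?thesis
      using cen[OF x False] False x by auto
  qed simp
  obtain x where x: "x \<in> carrier G" "x \<noteq> \<one>"
  proof -
    have "carrier G \<noteq> {\<one>}"
      using nt order_one_triv_iff by simp
    then show thesis
      using that one_closed by blast
  qed
  have inv: "inv y = y" if "y \<in> carrier G" for y
    using sq that inv_equality by blast
  have "x = \<one>"
  proof (rule triv)
    fix q assume q: "q \<in> carrier G"
    have "q \<otimes> x = inv (q \<otimes> x)"
      using inv[of "q \<otimes> x"] q x by simp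
    also have "\<dots> = inv x \<otimes> inv q"
      using q x by (simp add: inv_mult_group)
    also have "\<dots> = x \<otimes> q"
      using inv[OF q] inv[OF x(1)] by simp
    finally show "conj_by G q x \<in> {x, inv x}"
      using q x by (simp add: conj_by_fixed_iff)
  qed (fact x)
  then show False using x by simp
qed

lemma a4_like_of_commuting_pairs:
  assumes d: "5 * (order G)\<^sup>2 < 16 * commuting_pairs G" and "order G \<noteq> 1"
  shows "\<exists>K. a4_like G K"
proof -
  obtain x where x: "x \<in> carrier G" and 3: "card (conj_class G x) = 3"
    using exists_class3[OF assms] by blast
  obtain y z where cl: "conj_class G x = {x, y, z}" and d3: "x \<noteq> y" "x \<noteq> z" "y \<noteq> z"
  proof -
    obtain a b c where abc: "conj_class G x = {a, b, c}" "a \<noteq> b" "b \<noteq> c" "a \<noteq> c"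
      using 3 card_3_iff by metis
    moreover have "x \<in> {a, b, c}"
      using abc conj_class_self[OF x] by simp
    ultimately show thesis
      using that by blast
  qed
  have yz: "y \<in> carrier G" "z \<in> carrier G"
    using conj_class_subset[OF x] cl by auto
  have n1: "x \<noteq> \<one>" "y \<noteq> \<one>" "z \<noteq> \<one>"
  proof -
    have "\<one> \<notin> conj_class G x"
    proof
      assume one: "\<one> \<in> conj_class G x"
      have "u = \<one>" if "u \<in> conj_class G x" for u
        using conj_class_trans[OF x one that] by auto
      then have "x = \<one>" "y = \<one>"
        unfolding cl by blast+
      then show False using d3 by simp
    qed
    then show "x \<noteq> \<one>" "y \<noteq> \<one>" "z \<noteq> \<one>"
      using cl by auto
  qed
  have mem: "conj_by G q x \<in> {x, y, z}" "conj_by G q y \<in> {x, y, z}" "conj_by G q z \<in> {x, y, z}"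
    if "q \<in> carrier G" for q
    using conj_class_closed[OF that x, unfolded cl] by auto
  have inj: "conj_by G q x \<noteq> conj_by G q y" "conj_by G q x \<noteq> conj_by G q z"
       "conj_by G q y \<noteq> conj_by G q z" if "q \<in> carrier G" for q
    using that x yz d3 by (simp_all add: conj_by_cancel)
  \<comment> \<open>\<open>K\<close> is the kernel of the conjugation action on the class: whatever
    fixes \<open>x\<close> and \<open>y\<close> also fixes \<open>z\<close>.\<close>
  define n K k where "n = order G" and "K = {q \<in> carrier G. conj_by G q x = x \<and> conj_by G q y = y}"
    and "k = card K"
  have pos: "n > 0"
    using fin order_gt_0_iff_finite n_def by blast
  have K_sub: "K \<subseteq> carrier G" and fK: "finite K"
    using fin by (auto simp: K_def)
  have com: "u \<otimes> v = v \<otimes> u" if "u \<in> {x, y, z}" "v \<in> {x, y, z}" for u v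
    using class3_commute'[OF x 3, of u v, unfolded cl] that by blast
  have four: "{\<one>, x, y, z} \<subseteq> K"
  proof -
    have "conj_by G u v = v" if "u \<in> {x, y, z}" "v \<in> {x, y, z}" for u v
      using that x yz com[OF that] by (metis conj_by_fixed_iff insertE emptyE)
    then show ?thesis
      using x yz by (simp add: K_def)
  qed
  have card4: "card {\<one>, x, y, z} = 4"
    using n1 d3 by auto
  have k4: "k \<ge> 4"
    using card_mono[OF fK four] card4 by (simp add: k_def)
  have in_le: "3 * card (centralizer G q) \<le> n" if "q \<in> carrier G" "q \<noteq> \<one>" for q
    using mult_card_centralizer_le[OF that(1) card_class_ge3[OF that]] by (simp add: n_def)
  have out_le: "4 * card (centralizer G q) \<le> n" if q: "q \<in> carrier G" "q \<notin> K" for q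
  proof -
    have "conj_by G q x \<noteq> x \<or> conj_by G q y \<noteq> y"
      using q by (auto simp: K_def)
    \<comment> \<open>The five nontrivial permutations of three points: two 3-cycles and three
      transpositions.\<close>
    then consider "conj_by G q x = y" "conj_by G q y = z" "conj_by G q z = x"
      | "conj_by G q x = z" "conj_by G q z = y" "conj_by G q y = x"
      | "conj_by G q x = x" "conj_by G q y = z" "conj_by G q z = y"
      | "conj_by G q y = y" "conj_by G q x = z" "conj_by G q z = x"
      | "conj_by G q z = z" "conj_by G q x = y" "conj_by G q y = x"
      using mem[OF q(1)] inj[OF q(1)] by (metis insertE emptyE)
    then have "card (conj_class G q) \<ge> 4"
    proof cases
      case 1 then show ?thesis
        using cycle_class_ge4[OF x cl] d3 q by blast
    next
      case 2 then show ?thesis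
        using cycle_class_ge4[OF x, of x z y q] cl d3 q by (metis insert_commute)
    next
      case 3 then show ?thesis
        using swap_class_ge4[OF x cl] d3 q by blast
    next
      case 4 then show ?thesis
        using swap_class_ge4[OF x, of y x z q] cl d3 q by (metis insert_commute)
    next
      case 5 then show ?thesis
        using swap_class_ge4[OF x, of z x y q] cl d3 q by (metis insert_commute)
    qed
    then show ?thesis
      using mult_card_centralizer_le[OF q(1)] by (simp add: n_def)
  qed
  \<comment> \<open>The factor 12 clears the denominators of the bounds: \<open>n\<close> at the
    identity, \<open>n/3\<close> on the rest of \<open>K\<close>, \<open>n/4\<close> outside
    \<open>K\<close>.\<close>
  have "12 * commuting_pairs G = (\<Sum>q\<in>carrier G. 12 * card (centralizer G q))"
    by (simp add: commuting_pairs_def sum_distrib_left)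
  also have "\<dots> = (\<Sum>q\<in>K. 12 * card (centralizer G q)) + (\<Sum>q\<in>carrier G - K. 12 * card (centralizer G q))"
    using sum.subset_diff[OF K_sub fin] by (simp add: add.commute)
  also have "(\<Sum>q\<in>K. 12 * card (centralizer G q)) 
      = 12 * n + (\<Sum>q\<in>K - {\<one>}. 12 * card (centralizer G q))"
    using four fK by (subst sum.remove[of _ \<one>]) (auto simp: centralizer_one order_def n_def)
  also have "(\<Sum>q\<in>K - {\<one>}. 12 * card (centralizer G q)) \<le> (\<Sum>q\<in>K - {\<one>}. 4 * n)"
  proof (rule sum_mono)
    fix q assume "q \<in> K - {\<one>}"
    then have "3 * card (centralizer G q) \<le> n"
      using in_le K_sub by blast
    then show "12 * card (centralizer G q) \<le> 4 * n"
      by simp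
  qed
  also have "(\<Sum>q\<in>carrier G - K. 12 * card (centralizer G q)) \<le> (\<Sum>q\<in>carrier G - K. 3 * n)"
  proof (rule sum_mono)
    fix q assume "q \<in> carrier G - K"
    then have "4 * card (centralizer G q) \<le> n"
      using out_le by blast
    then show "12 * card (centralizer G q) \<le> 3 * n"
      by simp
  qed
  also have "(\<Sum>q\<in>K - {\<one>}. 4 * n) = (k - 1) * (4 * n)"
    using four fK by (simp add: k_def)
  also have "(\<Sum>q\<in>carrier G - K. 3 * n) = (n - k) * (3 * n)"
    using fK K_sub by (simp add: card_Diff_subset k_def n_def order_def)
  finally have up: "12 * commuting_pairs G \<le> 12 * n + (k - 1) * (4 * n) + (n - k) * (3 * n)"
    by simp
  have kn: "k \<le> n"
    using card_mono[OF fin K_sub] by (simp add: k_def n_def order_def)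
  have factor: "4 * (12 * n + i * (4 * n) + j * (3 * n)) = n * (4 * (12 + i * 4 + j * 3))" for i j
    by (simp add: algebra_simps)
  have "15 * n\<^sup>2 < 4 * (12 * n + (k - 1) * (4 * n) + (n - k) * (3 * n))"
    using up d by (simp add: n_def)
  also have "\<dots> = n * (4 * (12 + (k - 1) * 4 + (n - k) * 3))"
    using factor by blast
  finally have "n * (15 * n) < n * (4 * (12 + (k - 1) * 4 + (n - k) * 3))"
    by (simp add: power2_eq_square mult.left_commute)
  then have "15 * n < 4 * (12 + (k - 1) * 4 + (n - k) * 3)"
    using pos by simp
  then have bound: "3 * n < 32 + 4 * k"
    using k4 kn by simp
  have cx: "3 * card (centralizer G x) = n"
    using card_conj_class_centralizer[OF x] 3 by (simp add: n_def)
  have Kcx: "K \<subseteq> centralizer G x"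
    using x by (auto simp: K_def centralizer_iff)
  have fcx: "finite (centralizer G x)"
    using fin centralizer_subset by (rule rev_finite_subset)
  \<comment> \<open>The centralizer has \<open>n/3\<close> elements. If \<open>K\<close> were proper
    in it, then \<open>6k \<le> n\<close>, against \<open>3n < 32 + 4k\<close> and
    \<open>k \<ge> 4\<close>.\<close>
  have K_eq: "K = centralizer G x"
  proof (rule ccontr)
    assume ne: "K \<noteq> centralizer G x"
    have "K = centralizer G x \<inter> centralizer G y"
      using x yz by (auto simp: K_def centralizer_iff)
    then have "subgroup K G"
      using subgroups_Inter_pair[OF centralizer_subgroup[OF x] centralizer_subgroup[OF yz(1)]] by simp
    then have "2 * k \<le> card (centralizer G x)"
      unfolding k_def by (rule two_card_proper_subgroup_le[OF _ centralizer_subgroup[OF x] Kcx ne fcx])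
    then show False
      using cx bound k4 by linarith
  qed
  \<comment> \<open>With \<open>n = 3k\<close> the bound reads \<open>5k < 32\<close>.\<close>
  have nk: "n = 3 * k" and k6: "k \<le> 6"
    using K_eq cx bound by (simp_all add: k_def)
  have K_conj: "conj_by G g q \<in> K" if "g \<in> carrier G" "q \<in> K" for g q
  proof -
    have all: "conj_by G q v = v" if "v \<in> {x, y, z}" for v
    proof -
      have "conj_by G q x = x" "conj_by G q y = y" "q \<in> carrier G"
        using \<open>q \<in> K\<close> by (simp_all add: K_def)
      then show ?thesis
        using that mem[of q] inj[of q] by (metis insertE emptyE)
    qed
    have qc: "q \<in> carrier G"
      using that K_sub by auto
    have "conj_by G (conj_by G g q) v = v" if v: "v \<in> {x, y, z}" for v
    proof -
      have vc: "v \<in> carrier G"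
        using v x yz by auto
      have "conj_by G (inv g) v \<in> {x, y, z}"
        using mem[of "inv g"] \<open>g \<in> carrier G\<close> v by (metis insertE emptyE inv_closed)
      then have "conj_by G q (conj_by G (inv g) v) = conj_by G (inv g) v"
        using all by blast
      then have "conj_by G g (conj_by G q (conj_by G (inv g) v)) = v"
        using \<open>g \<in> carrier G\<close> vc by (simp add: conj_by_conj_by)
      then show ?thesis
        using \<open>g \<in> carrier G\<close> qc vc by (simp add: conj_by_conj_by conj_by_def[of G g q] m_assoc)
    qed
    then show ?thesis
      using qc \<open>g \<in> carrier G\<close> by (simp add: K_def)
  qed
  \<comment> \<open>\<open>K\<close>, \<open>{\<one>}\<close> and \<open>{x, y, z}\<close> are
    stable under conjugation. A further element of \<open>K\<close> would have its class, of size at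
    least three, among the remaining \<open>k - 4 \<le> 2\<close> elements.\<close>
  have "K = {\<one>, x, y, z}"
  proof (rule ccontr)
    assume "K \<noteq> {\<one>, x, y, z}"
    then have "\<not> K \<subseteq> {\<one>, x, y, z}"
      using four by (metis subset_antisym)
    then obtain r where r: "r \<in> K" "r \<notin> {\<one>, x, y, z}"
      by (meson subsetI)
    then have rc: "r \<in> carrier G" "r \<noteq> \<one>"
      using K_sub by auto
    have "conj_class G r \<subseteq> K - {\<one>, x, y, z}"
    proof
      fix u assume u: "u \<in> conj_class G r"
      then obtain g where g: "g \<in> carrier G" "u = conj_by G g r"
        by (auto simp: conj_class_def)
      then have ru: "r = conj_by G (inv g) u"
        using rc by (simp add: conj_by_conj_by)
      have "u \<noteq> \<one>"
        using ru r g by auto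
      moreover have "u \<notin> {x, y, z}"
        using ru r mem[of "inv g"] g by (metis insertE emptyE insertCI inv_closed)
      ultimately show "u \<in> K - {\<one>, x, y, z}"
        using K_conj[of g r] g r by auto
    qed
    then have "card (conj_class G r) \<le> card (K - {\<one>, x, y, z})"
      using fK by (intro card_mono) auto
    also have "\<dots> = k - 4"
      using card4 four fK by (simp add: card_Diff_subset k_def)
    finally show False
      using card_class_ge3[OF rc] k6 by simp
  qed
  then have k: "k = 4" and n: "n = 12" and Kx: "K = {\<one>, x, y, z}"
    using card4 nk by (simp_all add: k_def)
  show ?thesis
  proof (intro exI[of _ K] a4_like.intro a4_like_axioms.intro is_group)
    show "normal K G"
      unfolding normal_inv_iff
    proof (intro conjI ballI)
      show "subgroup K G"
        using centralizer_subgroup[OF x] K_eq by simp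
      fix g h assume "g \<in> carrier G" "h \<in> K"
      then show "g \<otimes> h \<otimes> inv g \<in> K"
        using K_conj unfolding conj_by_def by blast
    qed
    show "order G = 12" "card K = 4"
      using n k by (simp_all add: n_def k_def)
    show "centralizer G u = K" if "u \<in> K" "u \<noteq> \<one>" for u
    proof -
      have u: "u \<in> {x, y, z}" "u \<in> carrier G"
        using that Kx K_sub by auto
      have "K \<subseteq> centralizer G u"
      proof
        fix v assume v: "v \<in> K"
        then have "v = \<one> \<or> v \<in> {x, y, z}"
          using Kx by blast
        then have "v \<otimes> u = u \<otimes> v"
          using com[of v u] u by auto
        then show "v \<in> centralizer G u"
          using v K_sub by (auto simp: centralizer_def)
      qed
      moreover have "card (centralizer G u) \<le> card K"
        using in_le[OF u(2) that(2)] n k by (simp add: k_def)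
      moreover have "finite (centralizer G u)"
        using fin centralizer_subset by (rule rev_finite_subset)
      ultimately show ?thesis
        by (metis card_seteq)
    qed
    show "card (centralizer G g) \<le> 3" if "g \<in> carrier G" "g \<notin> K" for g
      using out_le[OF that] n by simp
  qed
qed

end

subsection \<open>The alternating group of degree four\<close>

context a4_like
begin

lemma finite_G: "finite (carrier G)"
  using order_12 order_gt_0_iff_finite by simp

lemma subgroup_K: "subgroup K G"
  using normal_K by (rule normal_imp_subgroup)

lemma K_subset: "K \<subseteq> carrier G"
  using subgroup_K by (rule subgroup.subset)

lemma one_in_K: "\<one> \<in> K"
  using subgroup_K by (rule subgroup.one_closed)

text \<open>A nontrivial \<open>k\<close> in \<open>K\<close> has centralizer \<open>K\<close>,
  which omits \<open>t\<close>. In other words, conjugation by \<open>t\<close> acts on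
  \<open>K\<close> without nontrivial fixed points.\<close>

lemma centralizer_Int_K:
  assumes "t \<in> carrier G" "t \<notin> K" "k \<in> K" "k \<in> centralizer G t"
  shows "k = \<one>"
proof (rule ccontr)
  assume "k \<noteq> \<one>"
  then have "t \<in> K"
    using centralizer_in[of k] centralizer_commute[of t G k] assms by blast
  then show False using assms by simp
qed

lemma cube_in_K:
  assumes t: "t \<in> carrier G" shows "t \<otimes> (t \<otimes> t) \<in> K"
proof -
  interpret n: normal K G by (rule normal_K)
  interpret Q: group "G Mod K" by (rule n.factorgroup_is_group)
  have "card (rcosets K) = 3"
    using lagrange[OF subgroup_K] order_12 card_K by simp
  then have "order (G Mod K) = 3"
    by (simp add: order_def FactGroup_def)
  moreover have tc: "K #> t \<in> carrier (G Mod K)"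
    using t by (auto simp: carrier_FactGroup)
  ultimately have "(K #> t) [^]\<^bsub>G Mod K\<^esub> (3::nat) = \<one>\<^bsub>G Mod K\<^esub>"
    using Q.pow_order_eq_1 by metis
  then have "K #> (t [^] (3::nat)) = K"
    using n.FactGroup_pow[OF t] by simp
  then have "t [^] (3::nat) \<in> K"
    using rcos_self[OF nat_pow_closed[OF t] subgroup_K] by metis
  then show ?thesis
    using t by (simp add: numeral_3_eq_3 m_assoc)
qed

text \<open>The cube lies in \<open>K\<close>, which has index three, and commutes with
  \<open>t\<close>, so \<open>centralizer_Int_K\<close> makes it trivial. The distinct elements
  \<open>\<one>\<close>, \<open>t\<close>, \<open>t \<otimes> t\<close> fill the centralizer, which
  leaves \<open>12 / 3\<close> conjugates.\<close>

lemma outside_K: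
  assumes t: "t \<in> carrier G" "t \<notin> K"
  shows "t \<otimes> (t \<otimes> t) = \<one>" "card (conj_class G t) = 4"
proof -
  have sq: "t \<otimes> t \<notin> K"
  proof
    assume "t \<otimes> t \<in> K"
    then have "t \<otimes> (t \<otimes> t) \<otimes> inv (t \<otimes> t) \<in> K"
      using cube_in_K[OF t(1)] subgroup_K by (simp add: subgroup.m_closed subgroup.m_inv_closed)
    moreover have "t \<otimes> s \<otimes> inv s = t" if "s \<in> carrier G" for s
      using that t by (simp add: m_assoc)
    ultimately show False
      using t by simp
  qed
  have sub: "{\<one>, t, t \<otimes> t} \<subseteq> centralizer G t"
    using t by (auto simp: centralizer_def m_assoc)
  have "\<one> \<noteq> t" "\<one> \<noteq> t \<otimes> t"
    using t sq one_in_K by metis+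
  moreover from this have "t \<noteq> t \<otimes> t"
    using t by simp
  ultimately have "card {\<one>, t, t \<otimes> t} = 3"
    by simp
  then have c3: "card (centralizer G t) = 3"
    using centralizer_out[OF t] sub card_seteq[OF _ sub]
      finite_subset[OF centralizer_subset finite_G] by auto
  have "t \<otimes> (t \<otimes> t) \<in> centralizer G t"
    using t by (simp add: centralizer_def m_assoc)
  then show "t \<otimes> (t \<otimes> t) = \<one>"
    using centralizer_Int_K[OF t] cube_in_K[OF t(1)] by blast
  show "card (conj_class G t) = 4"
    using card_conj_class_centralizer[OF t(1)] c3 order_12 by simp
qed

lemma fixing_class_trivial:
  assumes t: "t \<in> carrier G" "t \<notin> K" and g: "g \<in> carrier G"
    and fixes_class: "\<And>s. s \<in> conj_class G t \<Longrightarrow> conj_by G g s = s"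
  shows "g = \<one>"
proof -
  interpret n: normal K G by (rule normal_K)
  have "\<not> K \<subseteq> {\<one>}"
    using card_K card_mono[of "{\<one>}" K] by auto
  then obtain k where k: "k \<in> K" "k \<noteq> \<one>"
    by blast
  then have kc: "k \<in> carrier G"
    using K_subset by blast
  \<comment> \<open>As a quotient of two conjugates of \<open>t\<close>, \<open>v\<close> commutes
    with \<open>g\<close>; as a commutator of \<open>inv t\<close> and \<open>k\<close>, it lies in
    the normal subgroup \<open>K\<close>. Since \<open>v\<close> is nontrivial, \<open>g\<close>
    lies in \<open>K\<close>, and \<open>g\<close> commutes with \<open>t\<close>.\<close>
  define v where "v = inv t \<otimes> conj_by G k t"
  have "v = (inv t \<otimes> k \<otimes> t) \<otimes> inv k"
    using t kc by (simp add: v_def conj_by_def m_assoc)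
  then have vK: "v \<in> K"
    using n.inv_op_closed1[OF t(1) k(1)] k by simp
  have v1: "v \<noteq> \<one>"
  proof
    assume "v = \<one>"
    then have "conj_by G k t = t"
      using t kc unfolding v_def by (metis conj_by_closed inv_closed inv_equality inv_inv inv_comm)
    then have "k \<in> centralizer G t"
      using t kc by (simp add: centralizer_iff)
    then show False
      using centralizer_Int_K[OF t k(1)] k by simp
  qed
  have vc: "v \<in> carrier G"
    using vK K_subset by blast
  have gt: "conj_by G g t = t"
    using fixes_class conj_class_self t by blast
  have "conj_by G g (conj_by G k t) = conj_by G k t"
    using fixes_class kc by (auto simp: conj_class_def)
  then have "conj_by G g v = v"
    using g t kc gt by (simp add: v_def conj_by_mult conj_by_inv)
  then have "g \<in> centralizer G v"
    using g vc by (simp add: centralizer_iff)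
  then have "g \<in> K"
    using centralizer_in[OF vK v1] by simp
  then show ?thesis
    using centralizer_Int_K[OF t] gt g t by (simp add: centralizer_iff)
qed

lemma exists_outside_K: "\<exists>t\<in>carrier G. t \<notin> K"
proof -
  have "K \<noteq> carrier G"
    using order_12 card_K by (auto simp: order_def)
  then show ?thesis
    using K_subset by blast
qed

lemma center_trivial: "group_center G = {\<one>}"
proof -
  obtain t where t: "t \<in> carrier G" "t \<notin> K"
    using exists_outside_K by blast
  have "z = \<one>" if "z \<in> group_center G" for z
    using that t conj_class_subset[OF t(1)]
    by (intro fixing_class_trivial[OF t]) (auto simp: group_center_def conj_by_fixed_iff)
  then show ?thesis
    by (auto simp: group_center_def)
qed

text \<open>Conjugation on the four conjugates of an element outside \<open>K\<close> is faithful.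
  Elements outside \<open>K\<close> have trivial cube, hence sign 1, and each element of
  \<open>K\<close> is a product of two of them; so all images are even, and both orders are
  12.\<close>

lemma iso_alt_group_4: "\<exists>\<rho>. \<rho> \<in> iso G (alt_group 4)"
proof -
  obtain t where t: "t \<in> carrier G" "t \<notin> K"
    using exists_outside_K by blast
  define S where "S = conj_class G t"
  have S: "finite S" "card S = 4" "S \<subseteq> carrier G"
    using outside_K[OF t] conj_class_subset[OF t(1)] by (auto simp: S_def intro: card_ge_0_finite)
  obtain b where b: "bij_betw b {1..4::nat} S"
    using ex_bij_betw_nat_finite_1[OF S(1)] S(2) by auto
  \<comment> \<open>\<open>b\<close> numbers the conjugates from 1 to 4; the identity elsewhere is
    what \<open>permutes\<close> requires.\<close>
  define \<rho> where "\<rho> q i = (if i \<in> {1..4} then inv_into {1..4} b (conj_by G q (b i)) else i)" for q i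
  have bS: "b i \<in> S" if "i \<in> {1..4}" for i
    using b that by (auto simp: bij_betw_def)
  have cl: "conj_by G q s \<in> S" if "q \<in> carrier G" "s \<in> S" for q s
    using that conj_class_closed t by (auto simp: S_def)
  have b\<rho>: "b (\<rho> q i) = conj_by G q (b i)" "\<rho> q i \<in> {1..4}" if "i \<in> {1..4}" "q \<in> carrier G" for q i
  proof -
    have "conj_by G q (b i) \<in> b ` {1..4}"
      using b cl[OF that(2) bS[OF that(1)]] by (auto simp: bij_betw_def)
    then show "b (\<rho> q i) = conj_by G q (b i)" "\<rho> q i \<in> {1..4}"
      unfolding \<rho>_def using that by (simp_all add: f_inv_into_f inv_into_into del: atLeastAtMost_iff)
  qed
  have bcan: "i = j" if "i \<in> {1..4}" "j \<in> {1..4}" "b i = b j" for i j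
    using b that by (auto simp: bij_betw_def inj_on_def)
  have out: "\<rho> q i = i" if "i \<notin> {1..4}" for q i
    using that by (simp only: \<rho>_def if_False)
  have perm: "\<rho> q permutes {1..4}" if "q \<in> carrier G" for q
  proof (rule inj_imp_permutes)
    show "inj_on (\<rho> q) {1..4}"
    proof (rule inj_onI)
      fix i j assume ij: "i \<in> {1..4::nat}" "j \<in> {1..4}" "\<rho> q i = \<rho> q j"
      then have "conj_by G q (b i) = conj_by G q (b j)"
        using b\<rho> that by metis
      then show "i = j"
        using ij bcan bS S(3) that by (metis conj_by_cancel subsetD)
    qed
  qed (use b\<rho> that out in auto)
  have mult: "\<rho> (p \<otimes> q) = \<rho> p \<circ> \<rho> q" if pq: "p \<in> carrier G" "q \<in> carrier G" for p q
  proof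
    fix i show "\<rho> (p \<otimes> q) i = (\<rho> p \<circ> \<rho> q) i"
    proof (cases "i \<in> {1..4}")
      case True
      have "b (\<rho> p (\<rho> q i)) = conj_by G p (b (\<rho> q i))"
        using b\<rho>(1)[OF b\<rho>(2)[OF True pq(2)] pq(1)] .
      also have "\<dots> = b (\<rho> (p \<otimes> q) i)"
        using b\<rho>(1)[OF True] pq bS[OF True] S(3) by (auto simp: conj_by_conj_by)
      finally show ?thesis
        using bcan[of "\<rho> p (\<rho> q i)" "\<rho> (p \<otimes> q) i"] b\<rho>(2) True pq by simp
    qed (simp add: out)
  qed
  have sgn_mult: "sign (\<rho> (p \<otimes> q)) = sign (\<rho> p) * sign (\<rho> q)" if "p \<in> carrier G" "q \<in> carrier G" for p q
    using sign_compose[OF permutes_imp_permutation[OF _ perm] permutes_imp_permutation[OF _ perm], of p q] that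
    by (simp add: mult)
  have \<rho>1: "\<rho> \<one> = id"
  proof
    fix i show "\<rho> \<one> i = id i"
    proof (cases "i \<in> {1..4}")
      case True
      then show ?thesis
        using b\<rho>[OF True one_closed] bS[OF True] S(3) bcan[OF _ True] by auto
    qed (simp add: out)
  qed
  have sgn_out: "sign (\<rho> q) = 1" if "q \<in> carrier G" "q \<notin> K" for q
  proof -
    have "sign (\<rho> q) * (sign (\<rho> q) * sign (\<rho> q)) = sign (\<rho> (q \<otimes> (q \<otimes> q)))"
      using that sgn_mult by simp
    also have "\<dots> = 1"
      using outside_K(1)[OF that] \<rho>1 by simp
    finally show ?thesis by simp
  qed
  have sgn: "sign (\<rho> q) = 1" if q: "q \<in> carrier G" for q
  proof (cases "q \<in> K")
    case True
    have "q \<otimes> t \<notin> K"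
    proof
      assume "q \<otimes> t \<in> K"
      then have "inv q \<otimes> (q \<otimes> t) \<in> K"
        using True subgroup_K by (simp add: subgroup.m_closed subgroup.m_inv_closed)
      then show False
        using t q by (simp add: m_assoc[symmetric])
    qed
    moreover have "inv t \<notin> K"
      using t subgroup_K by (metis inv_inv subgroup.m_inv_closed)
    moreover have "q = (q \<otimes> t) \<otimes> inv t"
      using q t by (simp add: m_assoc)
    ultimately show ?thesis
      using sgn_mult[of "q \<otimes> t" "inv t"] sgn_out q t by simp
  qed (use sgn_out q in simp)
  have hom: "\<rho> \<in> hom G (alt_group 4)"
  proof (rule homI)
    show "\<rho> q \<in> carrier (alt_group 4)" if "q \<in> carrier G" for q
      using perm[OF that] sgn[OF that] by (auto simp: alt_group_carrier sign_def split: if_splits)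
  qed (simp add: alt_group_mult mult)
  have inj: "inj_on \<rho> (carrier G)"
  proof (rule inj_onI)
    fix p q assume pq: "p \<in> carrier G" "q \<in> carrier G" "\<rho> p = \<rho> q"
    have "inv p \<otimes> q = \<one>"
    proof (rule fixing_class_trivial[OF t])
      fix s assume s: "s \<in> conj_class G t"
      then have "s \<in> b ` {1..4}"
        unfolding bij_betw_imp_surj_on[OF b] S_def .
      then obtain i where i: "i \<in> {1..4}" "s = b i"
        by (elim imageE)
      have sc: "s \<in> carrier G"
        using s S by (auto simp: S_def)
      have "conj_by G q s = conj_by G p s"
        using b\<rho>(1)[OF i(1)] pq i by metis
      then have "conj_by G (inv p) (conj_by G q s) = s"
        using pq sc by (simp add: conj_by_conj_by)
      then show "conj_by G (inv p \<otimes> q) s = s"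
        using pq sc by (simp add: conj_by_conj_by)
    qed (use pq in auto)
    then show "p = q"
      using pq by (metis inv_closed inv_equality inv_inv)
  qed
  have "2 * card (carrier (alt_group 4)) = fact 4"
    by (rule alt_group_card_carrier) simp
  then have c12: "card (carrier (alt_group 4)) = 12"
    by (simp add: fact_numeral)
  have "\<rho> ` carrier G = carrier (alt_group 4)"
  proof (rule card_subset_eq)
    show "finite (carrier (alt_group 4))"
      using c12 card.infinite by fastforce
    show "\<rho> ` carrier G \<subseteq> carrier (alt_group 4)"
      using hom by (auto simp: hom_def)
    show "card (\<rho> ` carrier G) = card (carrier (alt_group 4))"
      using card_image[OF inj] c12 order_12 by (simp add: order_def)
  qed
  then show ?thesis
    using hom inj by (auto simp: iso_def bij_betw_def)
qed

end

subsection \<open>Isoclinism from a homomorphism\<close>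

lemma (in group_hom) group_center_eq_kernel:
  assumes surj: "h ` carrier G = carrier H"
    and ker: "kernel G H h \<subseteq> group_center G"
    and cen: "group_center H = {\<one>\<^bsub>H\<^esub>}"
  shows "group_center G = kernel G H h"
proof
  show "group_center G \<subseteq> kernel G H h"
  proof
    fix z assume z: "z \<in> group_center G"
    then have zc: "z \<in> carrier G" and com: "\<And>x. x \<in> carrier G \<Longrightarrow> z \<otimes> x = x \<otimes> z"
      by (auto simp: group_center_def)
    have "h z \<in> group_center H"
      unfolding group_center_def
    proof (intro CollectI conjI ballI)
      fix y assume "y \<in> carrier H"
      then obtain x where x: "x \<in> carrier G" "y = h x"
        using surj by auto
      show "h z \<otimes>\<^bsub>H\<^esub> y = y \<otimes>\<^bsub>H\<^esub> h z"
        using com[OF x(1)] zc x by (metis hom_mult)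
    qed (use zc in auto)
    then show "z \<in> kernel G H h"
      using cen zc by (simp add: kernel_def)
  qed
qed (fact ker)

text \<open>Both isomorphisms come from \<open>h\<close>. The center of \<open>G\<close> is the
  kernel and that of \<open>H\<close> is trivial, so the image of a central coset is a singleton,
  again a coset of the center. On the derived subgroup \<open>h\<close> is injective because that
  subgroup meets the kernel trivially.\<close>

lemma (in group_hom) isoclinicI:
  assumes surj: "h ` carrier G = carrier H"
    and ker: "kernel G H h \<subseteq> group_center G"
    and cen: "group_center H = {\<one>\<^bsub>H\<^esub>}"
    and der: "kernel G H h \<inter> derived G (carrier G) \<subseteq> {\<one>}"
  shows "isoclinic G H"
proof -
  define Z where "Z = kernel G H h"
  have ZG: "group_center G = Z"
    using group_center_eq_kernel[OF surj ker cen] by (simp add: Z_def)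
  have coset: "h ` (Z #> g) = {h g}" if "g \<in> carrier G" for g
    using that by (force simp: Z_def r_coset_def kernel_def)
  have cosH: "{\<one>\<^bsub>H\<^esub>} #>\<^bsub>H\<^esub> y = {y}" if "y \<in> carrier H" for y
    using that by (simp add: r_coset_def)
  have phi: "(\<lambda>X. h ` X) \<in> iso (G Mod Z) (H Mod {\<one>\<^bsub>H\<^esub>})"
  proof (rule isoI)
    show "(\<lambda>X. h ` X) \<in> hom (G Mod Z) (H Mod {\<one>\<^bsub>H\<^esub>})"
    proof (rule homI)
      fix X assume "X \<in> carrier (G Mod Z)"
      then obtain g where g: "g \<in> carrier G" "X = Z #> g"
        by (auto simp: carrier_FactGroup)
      then show "h ` X \<in> carrier (H Mod {\<one>\<^bsub>H\<^esub>})"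
        using coset cosH[of "h g"] by (auto simp: carrier_FactGroup intro!: image_eqI[where x = "h g"])
    next
      fix X Y assume "X \<in> carrier (G Mod Z)" "Y \<in> carrier (G Mod Z)"
      then obtain g g' where g: "g \<in> carrier G" "X = Z #> g" "g' \<in> carrier G" "Y = Z #> g'"
        by (auto simp: carrier_FactGroup)
      then have "X \<subseteq> carrier G" "Y \<subseteq> carrier G"
        by (auto simp: Z_def kernel_def r_coset_def)
      then show "h ` (X \<otimes>\<^bsub>G Mod Z\<^esub> Y) = h ` X \<otimes>\<^bsub>H Mod {\<one>\<^bsub>H\<^esub>}\<^esub> h ` Y"
        using set_mult_hom[OF homh] by simp
    qed
    show "bij_betw (\<lambda>X. h ` X) (carrier (G Mod Z)) (carrier (H Mod {\<one>\<^bsub>H\<^esub>}))"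
      unfolding bij_betw_def
    proof
      show "inj_on (\<lambda>X. h ` X) (carrier (G Mod Z))"
      proof (rule inj_onI)
        fix X Y assume "X \<in> carrier (G Mod Z)" "Y \<in> carrier (G Mod Z)" and eq: "h ` X = h ` Y"
        then obtain g g' where g: "g \<in> carrier G" "X = Z #> g" "g' \<in> carrier G" "Y = Z #> g'"
          by (auto simp: carrier_FactGroup)
        then have "h g = h g'"
          using eq coset by auto
        then show "X = Y"
          using g FactGroup_subset[of g g'] FactGroup_subset[of g' g] by (auto simp: Z_def)
      qed
      have "carrier (H Mod {\<one>\<^bsub>H\<^esub>}) = (\<lambda>y. {y}) ` h ` carrier G"
        using cosH surj by (simp add: carrier_FactGroup)
      also have "\<dots> = (\<lambda>X. h ` X) ` carrier (G Mod Z)"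
        using coset by (force simp: carrier_FactGroup image_image)
      finally show "(\<lambda>X. h ` X) ` carrier (G Mod Z) = carrier (H Mod {\<one>\<^bsub>H\<^esub>})" ..
    qed
  qed
  have dc: "derived G (carrier G) \<subseteq> carrier G"
    by (rule G.derived_in_carrier) simp
  have psi: "h \<in> iso (derived_subgroup G) (derived_subgroup H)"
  proof (rule isoI)
    have img: "h ` derived G (carrier G) = derived H (carrier H)"
      using derived_img[of "carrier G"] surj by simp
    show "h \<in> hom (derived_subgroup G) (derived_subgroup H)"
    proof (rule homI)
      show "\<And>x. x \<in> carrier (derived_subgroup G) \<Longrightarrow> h x \<in> carrier (derived_subgroup H)"
        using img by (auto simp: derived_subgroup_def)
      show "\<And>x y. \<lbrakk>x \<in> carrier (derived_subgroup G); y \<in> carrier (derived_subgroup G)\<rbrakk>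
        \<Longrightarrow> h (x \<otimes>\<^bsub>derived_subgroup G\<^esub> y) = h x \<otimes>\<^bsub>derived_subgroup H\<^esub> h y"
        using dc by (simp add: derived_subgroup_def subsetD)
    qed
    have "inj_on h (derived G (carrier G))"
    proof (rule inj_onI)
      fix x y assume xy: "x \<in> derived G (carrier G)" "y \<in> derived G (carrier G)" "h x = h y"
      have sg: "subgroup (derived G (carrier G)) G"
        by (rule G.derived_is_subgroup) simp
      have c: "x \<in> carrier G" "y \<in> carrier G"
        using xy dc by auto
      have "x \<otimes> inv y \<in> derived G (carrier G)"
        using xy sg by (simp add: subgroup.m_closed subgroup.m_inv_closed)
      moreover have "x \<otimes> inv y \<in> kernel G H h"
        using xy c by (simp add: kernel_def)
      ultimately have "x \<otimes> inv y = \<one>"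
        using der by blast
      then show "x = y"
        using c by (metis G.inv_closed G.inv_equality G.inv_inv)
    qed
    then show "bij_betw h (carrier (derived_subgroup G)) (carrier (derived_subgroup H))"
      using img by (simp add: bij_betw_def derived_subgroup_def)
  qed
  have comm: "h (commutator G g1 g2) = commutator H h1 h2"
    if "g1 \<in> carrier G" "g2 \<in> carrier G" "h1 \<in> carrier H" "h2 \<in> carrier H"
      "h ` (Z #> g1) = {\<one>\<^bsub>H\<^esub>} #>\<^bsub>H\<^esub> h1" "h ` (Z #> g2) = {\<one>\<^bsub>H\<^esub>} #>\<^bsub>H\<^esub> h2" for g1 g2 h1 h2
  proof -
    have "h g1 = h1" "h g2 = h2"
      using that coset cosH by auto
    then show ?thesis
      using that by (simp add: commutator_def)
  qed
  show ?thesis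
    unfolding isoclinic_def ZG cen
  proof (rule bexI[OF bexI[OF _ psi] phi], intro ballI impI)
    fix g1 g2 h1 h2
    assume "g1 \<in> carrier G" "g2 \<in> carrier G" "h1 \<in> carrier H" "h2 \<in> carrier H"
      "h ` (Z #> g1) = {\<one>\<^bsub>H\<^esub>} #>\<^bsub>H\<^esub> h1" "h ` (Z #> g2) = {\<one>\<^bsub>H\<^esub>} #>\<^bsub>H\<^esub> h2"
    then show "h (commutator G g1 g2) = commutator H h1 h2"
      by (rule comm)
  qed
qed

subsection \<open>Commuting pairs in extensions\<close>

lemma (in group) group_center_iff:
  "z \<in> group_center G \<longleftrightarrow> z \<in> carrier G \<and> (\<forall>x\<in>carrier G. z \<in> centralizer G x)"
  by (auto simp: group_center_def centralizer_def)

lemma (in group) group_center_subgroup: "subgroup (group_center G) G"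
proof (rule subgroupI)
  have "\<one> \<in> group_center G"
    by (simp add: group_center_def)
  then show "group_center G \<noteq> {}"
    by blast
qed (use subgroup.m_closed[OF centralizer_subgroup] subgroup.m_inv_closed[OF centralizer_subgroup]
    in \<open>auto simp: group_center_iff\<close>)

lemma (in group_hom) vimage_subgroup:
  assumes "subgroup I H"
  shows "subgroup {g \<in> carrier G. h g \<in> I} G"
proof (rule G.subgroupI)
  have "\<one> \<in> {g \<in> carrier G. h g \<in> I}"
    using assms by (simp add: subgroup.one_closed)
  then show "{g \<in> carrier G. h g \<in> I} \<noteq> {}"
    by blast
qed (use assms in \<open>auto simp: subgroup.m_closed subgroup.m_inv_closed\<close>)

locale finite_epi = group_hom +
  assumes fin: "finite (carrier G)"
    and surj: "h ` carrier G = carrier H"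
begin

abbreviation N where "N \<equiv> kernel G H h"

lemma N_subset: "N \<subseteq> carrier G"
  by (auto simp: kernel_def)

lemma finite_N: "finite N"
  using N_subset fin by (rule finite_subset)

lemma finite_H: "finite (carrier H)"
  using fin surj by (metis finite_imageI)

lemma N_pos: "card N > 0"
  using finite_N subgroup.one_closed[OF subgroup_kernel] by (auto simp: card_gt_0_iff)

lemma same_image_diff:
  assumes "u \<in> carrier G" "v \<in> carrier G" "h u = h v"
  shows "inv u \<otimes> v \<in> N" "v = u \<otimes> (inv u \<otimes> v)"
  using assms by (simp_all add: kernel_def G.m_assoc[symmetric])

lemma card_fibre:
  assumes "y \<in> carrier H"
  shows "card {g \<in> carrier G. h g = y} = card N"
proof -
  have "y \<in> h ` carrier G"
    using assms surj by simp
  then obtain x where x: "x \<in> carrier G" "h x = y"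
    by blast
  have "{g \<in> carrier G. h g = y} = (\<lambda>m. x \<otimes> m) ` N"
  proof (intro equalityI subsetI)
    fix g assume "g \<in> {g \<in> carrier G. h g = y}"
    then show "g \<in> (\<lambda>m. x \<otimes> m) ` N"
      using same_image_diff[of x g] x by auto
  qed (use x in \<open>auto simp: kernel_def\<close>)
  moreover have "inj_on (\<lambda>m. x \<otimes> m) N"
    using x N_subset by (auto simp: inj_on_def subset_eq)
  ultimately show ?thesis
    by (simp add: card_image)
qed

lemma sum_comp_h: "(\<Sum>g\<in>carrier G. f (h g)) = card N * (\<Sum>y\<in>carrier H. (f y :: nat))"
proof -
  have "(\<Sum>g\<in>carrier G. f (h g)) = (\<Sum>y\<in>carrier H. \<Sum>g\<in>{g \<in> carrier G. h g = y}. f (h g))"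
    using sum.image_gen[OF fin, of "\<lambda>g. f (h g)" h] surj by simp
  also have "\<dots> = (\<Sum>y\<in>carrier H. card N * f y)"
    by (rule sum.cong) (simp_all add: card_fibre)
  finally show ?thesis
    by (simp add: sum_distrib_left)
qed

lemma card_vimage:
  assumes "I \<subseteq> carrier H"
  shows "card {g \<in> carrier G. h g \<in> I} = card N * card I"
proof -
  have "card {g \<in> carrier G. h g \<in> I} = (\<Sum>g\<in>carrier G. if h g \<in> I then 1 else 0)"
    using fin by (simp add: sum.If_cases Int_def)
  also have "\<dots> = card N * (\<Sum>y\<in>carrier H. if y \<in> I then 1 else 0)"
    by (rule sum_comp_h)
  also have "(\<Sum>y\<in>carrier H. if y \<in> I then 1 else 0) = card I"
    using finite_H assms by (simp add: sum.If_cases inf_absorb2)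
  finally show ?thesis .
qed

lemma order_eq: "order G = card N * order H"
proof -
  have "{g \<in> carrier G. h g \<in> carrier H} = carrier G"
    by auto
  then show ?thesis
    using card_vimage[of "carrier H"] by (simp add: order_def)
qed

text \<open>\<open>h\<close> maps the centralizer of \<open>g\<close> into that of
  \<open>h g\<close>, and dividing by a fixed member embeds each fibre of this restriction into
  \<open>centralizer G g \<inter> N\<close>.\<close>

lemma card_centralizer_le:
  assumes g: "g \<in> carrier G"
  shows "card (centralizer G g) \<le> card (centralizer H (h g)) * card (centralizer G g \<inter> N)"
proof -
  let ?C = "centralizer G g"
  have sg: "subgroup ?C G"
    using g by (rule G.centralizer_subgroup)
  have fC: "finite ?C"
    using G.centralizer_subset fin by (rule finite_subset)
  have img: "h ` ?C \<subseteq> centralizer H (h g)"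
  proof
    fix y assume "y \<in> h ` ?C"
    then obtain x where x: "x \<in> carrier G" "x \<otimes> g = g \<otimes> x" "y = h x"
      by (auto simp: centralizer_def)
    then show "y \<in> centralizer H (h g)"
      using g by (simp add: centralizer_def) (metis hom_mult)
  qed
  have "card ?C = (\<Sum>y\<in>h ` ?C. card {x \<in> ?C. h x = y})"
    using sum.image_gen[OF fC, of "\<lambda>_. 1::nat" h] by simp
  also have "\<dots> \<le> (\<Sum>y\<in>h ` ?C. card (?C \<inter> N))"
  proof (rule sum_mono)
    fix y assume "y \<in> h ` ?C"
    then obtain x where x: "x \<in> ?C" "y = h x"
      by blast
    show "card {x \<in> ?C. h x = y} \<le> card (?C \<inter> N)"
    proof (rule card_inj_on_le[where f = "\<lambda>u. inv x \<otimes> u"])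
      show "inj_on (\<lambda>u. inv x \<otimes> u) {x \<in> ?C. h x = y}"
        using x G.centralizer_subset[of g] by (auto simp: inj_on_def subset_eq)
      show "(\<lambda>u. inv x \<otimes> u) ` {x \<in> ?C. h x = y} \<subseteq> ?C \<inter> N"
        using x sg same_image_diff(1)[of x] G.centralizer_subset[of g]
        by (auto simp: subgroup.m_closed subgroup.m_inv_closed subset_eq)
    qed (use fC in simp)
  qed
  also have "\<dots> = card (h ` ?C) * card (?C \<inter> N)"
    by simp
  also have "\<dots> \<le> card (centralizer H (h g)) * card (?C \<inter> N)"
    using card_mono[OF finite_subset[OF H.centralizer_subset finite_H] img] by simp
  finally show ?thesis .
qed

lemma card_centralizer_Int_N_le: "card (centralizer G g \<inter> N) \<le> card N"
  using finite_N by (intro card_mono) auto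

text \<open>Since \<open>order G = card N * order H\<close>, this says that passing to a quotient
  does not lower the commuting probability.\<close>

lemma commuting_pairs_le: "commuting_pairs G \<le> (card N)\<^sup>2 * commuting_pairs H"
proof -
  have "commuting_pairs G \<le> (\<Sum>g\<in>carrier G. card (centralizer H (h g)) * card N)"
    unfolding commuting_pairs_def
  proof (rule sum_mono)
    fix g assume "g \<in> carrier G"
    then show "card (centralizer G g) \<le> card (centralizer H (h g)) * card N"
      using card_centralizer_le card_centralizer_Int_N_le by (meson le_trans mult_le_mono2)
  qed
  also have "\<dots> = card N * (\<Sum>y\<in>carrier H. card (centralizer H y) * card N)"
    by (rule sum_comp_h)
  finally show ?thesis
    by (simp add: commuting_pairs_def power2_eq_square ac_simps flip: sum_distrib_right)
qed

end

lemma (in a4_like) card_centralizer_cases: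
  assumes "y \<in> carrier G"
  shows "card (centralizer G y) \<le> (if y = \<one> then 12 else 4)"
proof (cases "y = \<one>")
  case True
  then show ?thesis
    using order_12 by (simp add: centralizer_one order_def)
next
  case False
  then show ?thesis
    using centralizer_in[of y] centralizer_out[of y] assms card_K by (cases "y \<in> K") auto
qed

lemma (in a4_like) sum_split:
  "(\<Sum>y\<in>carrier G. f y :: nat) = f \<one> + (\<Sum>y\<in>K - {\<one>}. f y) + (\<Sum>y\<in>carrier G - K. f y)"
proof -
  have "(\<Sum>y\<in>carrier G. f y) = (\<Sum>y\<in>carrier G - K. f y) + (\<Sum>y\<in>K. f y)"
    using K_subset finite_G by (rule sum.subset_diff)
  also have "(\<Sum>y\<in>K. f y) = f \<one> + (\<Sum>y\<in>K - {\<one>}. f y)"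
    using finite_subset[OF K_subset finite_G] one_in_K by (rule sum.remove)
  finally show ?thesis by simp
qed

text \<open>The twelve elements are the identity, the three others in \<open>K\<close>, and the
  eight outside \<open>K\<close>.\<close>

lemma (in a4_like) sum_le:
  assumes "f \<one> \<le> a" "\<And>y. \<lbrakk>y \<in> K; y \<noteq> \<one>\<rbrakk> \<Longrightarrow> f y \<le> b" "\<And>y. \<lbrakk>y \<in> carrier G; y \<notin> K\<rbrakk> \<Longrightarrow> f y \<le> c"
  shows "(\<Sum>y\<in>carrier G. f y :: nat) \<le> a + 3 * b + 8 * c"
proof -
  have fK: "finite K"
    using K_subset finite_G by (rule finite_subset)
  have "(\<Sum>y\<in>K - {\<one>}. f y) \<le> card (K - {\<one>}) * b"
    using sum_bounded_above[of "K - {\<one>}" f b] assms(2) by simp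
  moreover have "card (K - {\<one>}) = 3"
    using card_K one_in_K fK by simp
  moreover have "(\<Sum>y\<in>carrier G - K. f y) \<le> card (carrier G - K) * c"
    using sum_bounded_above[of "carrier G - K" f c] assms(3) by simp
  moreover have "card (carrier G - K) = 8"
    using card_K order_12 K_subset fK by (simp add: card_Diff_subset order_def)
  ultimately show ?thesis
    using assms(1) unfolding sum_split[of f] by simp
qed

section \<open>Dense extensions with an \<open>a4_like\<close> quotient: central kernel and abelian
  preimage of \<open>K\<close>\<close>

locale a4_quotient = finite_epi G H h + A: a4_like H K for G (structure) and H (structure) and h K +
  assumes dense: "5 * (order G)\<^sup>2 < 16 * commuting_pairs G"
begin

text \<open>Here \<open>45 = 5 * 144 / 16\<close>. As A_4 itself has 48 commuting pairs, the counts
  below can lose very little.\<close>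

lemma pairs_gt: "45 * (card N)\<^sup>2 < commuting_pairs G"
  using dense by (simp add: order_eq A.order_12 power_mult_distrib)

lemma kernel_central: "N \<subseteq> group_center G"
proof -
  define n where "n = card N"
  define c where "c y = card (centralizer H y)" for y
  define N0 where "N0 = {m \<in> N. centralizer G m = carrier G}"
  \<comment> \<open>Summing \<open>card_centralizer_le\<close> over \<open>g\<close> counts the
    commuting pairs \<open>(g, m)\<close> with \<open>m\<close> in the kernel, weighted by
    \<open>c (h g)\<close>; \<open>S m\<close> collects the pairs with a given
    \<open>m\<close>.\<close>
  define S where "S m = (\<Sum>g\<in>{g \<in> carrier G. m \<in> centralizer G g}. c (h g))" for m
  have Cm: "{g \<in> carrier G. m \<in> centralizer G g} = centralizer G m" if "m \<in> N" for m
    using that N_subset by (auto simp: centralizer_def)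
  have cle: "c y \<le> (if y = \<one>\<^bsub>H\<^esub> then 12 else 4)" if "y \<in> carrier H" for y
    using A.card_centralizer_cases[OF that] by (simp add: c_def)
  have csum: "(\<Sum>y\<in>carrier H. c y) \<le> 48"
  proof -
    have "(\<Sum>y\<in>carrier H. c y) \<le> 12 + 3 * 4 + 8 * 3"
    proof (rule A.sum_le)
      show "c \<one>\<^bsub>H\<^esub> \<le> 12"
        using cle[OF H.one_closed] by simp
      show "c y \<le> 4" if "y \<in> K" "y \<noteq> \<one>\<^bsub>H\<^esub>" for y
        using cle[of y] that A.K_subset by auto
      show "c y \<le> 3" if "y \<in> carrier H" "y \<notin> K" for y
        unfolding c_def using that by (rule A.centralizer_out)
    qed
    then show ?thesis by simp
  qed
  txt \<open>Exchanging the summations, \<open>S m\<close> is at most \<open>48 * n\<close> for central \<open>m\<close> and at most \<open>32 * n\<close> otherwise,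
    so the bound \<open>45 * n\<^sup>2\<close> makes more than half of the kernel central.\<close>
  have "commuting_pairs G \<le> (\<Sum>g\<in>carrier G. c (h g) * card {m \<in> N. m \<in> centralizer G g})"
    unfolding commuting_pairs_def
  proof (rule sum_mono)
    fix g assume "g \<in> carrier G"
    moreover have "centralizer G g \<inter> N = {m \<in> N. m \<in> centralizer G g}"
      by blast
    ultimately show "card (centralizer G g) \<le> c (h g) * card {m \<in> N. m \<in> centralizer G g}"
      using card_centralizer_le by (metis c_def)
  qed
  also have "\<dots> = (\<Sum>g\<in>carrier G. \<Sum>m\<in>{m \<in> N. m \<in> centralizer G g}. c (h g))"
    by (simp add: mult.commute)
  also have "\<dots> = (\<Sum>m\<in>N. S m)"
    unfolding S_def by (rule sum.swap_restrict[OF fin finite_N])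
  also have "\<dots> = (\<Sum>m\<in>N - N0. S m) + (\<Sum>m\<in>N0. S m)"
    by (rule sum.subset_diff[OF _ finite_N]) (auto simp: N0_def)
  also have "(\<Sum>m\<in>N0. S m) \<le> card N0 * (48 * n)"
  proof -
    have "S m \<le> 48 * n" if "m \<in> N0" for m
    proof -
      have "S m = (\<Sum>g\<in>carrier G. c (h g))"
        using that Cm[of m] by (simp add: S_def N0_def)
      also have "\<dots> = n * (\<Sum>y\<in>carrier H. c y)"
        unfolding n_def by (rule sum_comp_h)
      finally show ?thesis
        using csum by (simp add: mult.commute)
    qed
    then show ?thesis
      using sum_bounded_above[of N0 S "48 * n"] by simp
  qed
  also have "(\<Sum>m\<in>N - N0. S m) \<le> card (N - N0) * (32 * n)"
  proof -
    have "S m \<le> 32 * n" if m: "m \<in> N - N0" for m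
    proof -
      have mc: "m \<in> carrier G" and ne: "centralizer G m \<noteq> carrier G"
        using m N_subset by (auto simp: N0_def)
      have "2 * card (centralizer G m) \<le> card (carrier G)"
        by (rule G.two_card_proper_subgroup_le[OF G.centralizer_subgroup[OF mc] G.subgroup_self
              G.centralizer_subset ne fin])
      then have half: "card (centralizer G m) \<le> 6 * n"
        using order_eq A.order_12 by (simp add: order_def n_def)
      have fC: "finite (centralizer G m)"
        using G.centralizer_subset fin by (rule finite_subset)
      have "S m = (\<Sum>g\<in>centralizer G m. c (h g))"
        using Cm[of m] m by (simp add: S_def)
      \<comment> \<open>The weight is at most 12 at the identity, whose fibre is the kernel, and at
        most 4 elsewhere, so the total is at most \<open>4 * 6n + 8n\<close>.\<close>
      also have "\<dots> \<le> (\<Sum>g\<in>centralizer G m. 4 + (if g \<in> N then 8 else 0))"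
      proof (rule sum_mono)
        fix g assume "g \<in> centralizer G m"
        then have "g \<in> carrier G"
          using G.centralizer_subset by blast
        then show "c (h g) \<le> 4 + (if g \<in> N then 8 else 0)"
          using cle[of "h g"] by (auto simp: kernel_def split: if_splits)
      qed
      also have "\<dots> = 4 * card (centralizer G m) + 8 * card (centralizer G m \<inter> N)"
        using fC by (simp add: sum.distrib sum.If_cases)
      also have "\<dots> \<le> 32 * n"
        using half card_centralizer_Int_N_le[of m] by (simp add: n_def)
      finally show ?thesis .
    qed
    then show ?thesis
      using sum_bounded_above[of "N - N0" S "32 * n"] by simp
  qed
  also have "card (N - N0) = n - card N0"
    using finite_N by (subst card_Diff_subset) (auto simp: N0_def n_def intro: finite_subset)
  finally have le: "commuting_pairs G \<le> (n - card N0) * (32 * n) + card N0 * (48 * n)"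
    by simp
  have N0n: "card N0 \<le> n"
    using finite_N by (auto simp: N0_def n_def intro: card_mono)
  \<comment> \<open>This amounts to \<open>13n < 16 * card N0\<close>, so the subgroup
    \<open>N0\<close> contains more than half of \<open>N\<close> and hence all of it.\<close>
  have "n * (45 * n) < n * ((n - card N0) * 32 + card N0 * 48)"
    using le pairs_gt by (simp add: n_def power2_eq_square algebra_simps)
  then have "45 * n < (n - card N0) * 32 + card N0 * 48"
    by simp
  then have big: "n < 2 * card N0"
    using N0n by simp
  have "centralizer G m = carrier G \<longleftrightarrow> m \<in> group_center G" if "m \<in> N" for m
  proof -
    have "centralizer G m = carrier G \<longleftrightarrow> (\<forall>x\<in>carrier G. x \<in> centralizer G m)"
      using G.centralizer_subset by blast
    then show ?thesis
      using that N_subset by (auto simp: centralizer_def group_center_def)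
  qed
  then have N0_eq: "N0 = N \<inter> group_center G"
    by (auto simp: N0_def)
  have "subgroup (group_center G) G"
    by (rule G.group_center_subgroup)
  then have "subgroup N0 G"
    unfolding N0_eq using G.subgroups_Inter_pair subgroup_kernel by blast
  then have "N0 = N"
    using G.two_card_proper_subgroup_le[OF _ subgroup_kernel _ _ finite_N, of N0] big N0_eq
    by (auto simp: n_def)
  then show ?thesis
    using N0_eq by blast
qed

definition T where "T = {g \<in> carrier G. h g \<in> K}"

lemma T_subgroup: "subgroup T G"
  unfolding T_def by (rule vimage_subgroup[OF A.subgroup_K])

lemma card_T: "card T = 4 * card N"
  unfolding T_def using card_vimage[OF A.K_subset] A.card_K by simp

lemma N_commute: "\<lbrakk>m \<in> N; x \<in> carrier G\<rbrakk> \<Longrightarrow> m \<otimes> x = x \<otimes> m"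
  using kernel_central by (auto simp: group_center_def)

text \<open>\<open>u\<close> and \<open>v\<close> differ by a factor from the kernel, which is
  central; centralizers are therefore unions of fibres of \<open>h\<close>.\<close>

lemma mult_N_centralizer:
  assumes "u \<in> centralizer G w" "v \<in> carrier G" "h v = h u" "w \<in> carrier G"
  shows "v \<in> centralizer G w"
proof -
  have u: "u \<in> carrier G"
    using assms(1) by (simp add: centralizer_def)
  have "inv u \<otimes> v \<in> centralizer G w"
    using same_image_diff(1)[OF u assms(2)] N_commute[of "inv u \<otimes> v" w] assms u
    by (simp add: centralizer_def)
  then have "u \<otimes> (inv u \<otimes> v) \<in> centralizer G w"
    using assms(1) G.centralizer_subgroup[OF assms(4)] by (simp add: subgroup.m_closed)
  then show ?thesis
    using same_image_diff(2)[OF u assms(2)] assms by simp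
qed

text \<open>The centralizer of \<open>v\<close> contains the fibres of \<open>\<one>\<close>,
  \<open>g\<close> and \<open>v\<close>. If these are distinct, they make up three quarters of
  \<open>T\<close> and so force all of it; otherwise \<open>v\<close> differs from
  \<open>\<one>\<close> or \<open>g\<close> by a central factor.\<close>

lemma T_commute_of_central:
  assumes g: "g \<in> T" "g \<notin> N" and all: "T \<subseteq> centralizer G g" and v: "v \<in> T"
  shows "T \<subseteq> centralizer G v"
proof -
  have gc: "g \<in> carrier G" and vc: "v \<in> carrier G" and hg: "h g \<noteq> \<one>\<^bsub>H\<^esub>"
    using g v by (auto simp: T_def kernel_def)
  have comm_g: "g \<in> centralizer G u" if "u \<in> T" for u
    using centralizer_commute[OF gc] that all by (meson subsetD)
  have one: "\<one> \<in> centralizer G u" if "u \<in> carrier G" for u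
    using that by (simp add: centralizer_def)
  consider "h v = \<one>\<^bsub>H\<^esub>" | "h v = h g" | "card {\<one>\<^bsub>H\<^esub>, h g, h v} = 3"
  proof -
    have "card {\<one>\<^bsub>H\<^esub>, h g, h v} = 3" if "h v \<noteq> \<one>\<^bsub>H\<^esub>" "h v \<noteq> h g"
      using that hg by simp
    then show thesis
      using that by blast
  qed
  then show ?thesis
  proof cases
    case 1
    then have "v \<in> centralizer G u" if "u \<in> T" for u
      using that mult_N_centralizer[OF one, of u v] vc by (auto simp: T_def)
    then show ?thesis
      using vc by (auto simp: T_def centralizer_def)
  next
    case 2
    then have "v \<in> centralizer G u" if "u \<in> T" for u
      using that mult_N_centralizer[OF comm_g, of u v] vc by (auto simp: T_def)
    then show ?thesis
      using vc by (auto simp: T_def centralizer_def)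
  next
    case 3
    have sub: "{u \<in> carrier G. h u \<in> {\<one>\<^bsub>H\<^esub>, h g, h v}} \<subseteq> centralizer G v \<inter> T"
    proof
      fix u assume u: "u \<in> {u \<in> carrier G. h u \<in> {\<one>\<^bsub>H\<^esub>, h g, h v}}"
      then have "h u = h \<one> \<or> h u = h g \<or> h u = h v"
        by auto
      then have "u \<in> centralizer G v"
        using mult_N_centralizer[OF one, of v u] mult_N_centralizer[OF comm_g, of v u]
          mult_N_centralizer[OF G.centralizer_self, of v u] u v vc by blast
      moreover have "u \<in> T"
        using u g v A.one_in_K by (auto simp: T_def)
      ultimately show "u \<in> centralizer G v \<inter> T" by simp
    qed
    have "card {u \<in> carrier G. h u \<in> {\<one>\<^bsub>H\<^esub>, h g, h v}} = 3 * card N"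
      using card_vimage[of "{\<one>\<^bsub>H\<^esub>, h g, h v}"] 3 gc vc by simp
    moreover have fT: "finite T"
      using fin by (simp add: T_def)
    moreover have "finite (centralizer G v \<inter> T)"
      using fT by simp
    ultimately have "3 * card N \<le> card (centralizer G v \<inter> T)"
      using card_mono[OF _ sub] by simp
    then have "\<not> 2 * card (centralizer G v \<inter> T) \<le> card T"
      using card_T N_pos by simp
    moreover have "subgroup (centralizer G v \<inter> T) G"
      using G.subgroups_Inter_pair[OF G.centralizer_subgroup[OF vc] T_subgroup] .
    ultimately have "centralizer G v \<inter> T = T"
      using G.two_card_proper_subgroup_le[OF _ T_subgroup _ _ fT] by blast
    then show ?thesis by blast
  qed
qed

text \<open>If \<open>T\<close> is not abelian, no \<open>g\<close> in \<open>T\<close> outside the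
  kernel commutes with all of \<open>T\<close>. Its centralizer lies in \<open>T\<close>, since
  \<open>K\<close> is the centralizer of \<open>h g\<close>, and so has at most half the elements of
  \<open>T\<close>. The count becomes \<open>12 + 3 * 2 + 8 * 3 = 42\<close> times
  \<open>(card N)\<^sup>2\<close>, too small for \<open>pairs_gt\<close>.\<close>

lemma T_commute:
  assumes "u \<in> T" "v \<in> T" shows "u \<otimes> v = v \<otimes> u"
proof (rule ccontr)
  assume nc: "u \<otimes> v \<noteq> v \<otimes> u"
  have half: "card (centralizer G g) \<le> 2 * card N" if g: "g \<in> T" "g \<notin> N" for g
  proof -
    have gc: "g \<in> carrier G" "h g \<in> K" "h g \<noteq> \<one>\<^bsub>H\<^esub>"
      using g by (auto simp: T_def kernel_def)
    have "\<not> T \<subseteq> centralizer G v"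
      using nc assms by (auto simp: centralizer_def)
    then have "\<not> T \<subseteq> centralizer G g"
      using T_commute_of_central[OF g] assms by blast
    moreover have "centralizer G g \<subseteq> T"
    proof
      fix w assume "w \<in> centralizer G g"
      then have w: "w \<in> carrier G" "w \<otimes> g = g \<otimes> w"
        by (auto simp: centralizer_def)
      then have "h w \<in> centralizer H (h g)"
        using gc hom_mult[OF w(1) gc(1)] hom_mult[OF gc(1) w(1)] by (simp add: centralizer_def)
      then show "w \<in> T"
        using A.centralizer_in[OF gc(2,3)] w by (simp add: T_def)
    qed
    ultimately have "2 * card (centralizer G g) \<le> card T"
      using fin G.two_card_proper_subgroup_le[OF G.centralizer_subgroup[OF gc(1)] T_subgroup]
      by (metis T_def finite_Collect_conjI Collect_mem_eq order_refl)
    then show ?thesis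
      using card_T by simp
  qed
  define e where "e y = (if y = \<one>\<^bsub>H\<^esub> then 12 * card N else if y \<in> K then 2 * card N else 3 * card N)" for y
  have "commuting_pairs G \<le> (\<Sum>g\<in>carrier G. e (h g))"
    unfolding commuting_pairs_def
  proof (rule sum_mono)
    fix g assume g: "g \<in> carrier G"
    have le: "card (centralizer G g) \<le> card (centralizer H (h g)) * card N"
      using card_centralizer_le[OF g] card_centralizer_Int_N_le by (meson le_trans mult_le_mono2)
    consider "h g = \<one>\<^bsub>H\<^esub>" | "h g \<noteq> \<one>\<^bsub>H\<^esub>" "h g \<in> K" | "h g \<noteq> \<one>\<^bsub>H\<^esub>" "h g \<notin> K"
      by blast
    then show "card (centralizer G g) \<le> e (h g)"
    proof cases
      case 1
      then show ?thesis
        using le A.order_12 by (simp add: e_def H.centralizer_one order_def)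
    next
      case 2
      then show ?thesis
        using half[of g] g by (simp add: e_def T_def kernel_def)
    next
      case 3
      then have "card (centralizer H (h g)) * card N \<le> 3 * card N"
        using A.centralizer_out[of "h g"] g by simp
      then have "card (centralizer G g) \<le> 3 * card N"
        using le by (rule le_trans[rotated])
      then show ?thesis
        using 3 by (simp add: e_def)
    qed
  qed
  also have "\<dots> = card N * (\<Sum>y\<in>carrier H. e y)"
    by (rule sum_comp_h)
  also have "(\<Sum>y\<in>carrier H. e y) \<le> 12 * card N + 3 * (2 * card N) + 8 * (3 * card N)"
    by (rule A.sum_le) (use A.one_in_K in \<open>auto simp: e_def\<close>)
  finally have "commuting_pairs G \<le> 42 * (card N)\<^sup>2"
    by (simp add: power2_eq_square)
  then show False
    using pairs_gt by simp
qed

end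

section \<open>The derived subgroup of the extension and the isoclinism with A_4\<close>

context a4_quotient
begin

text \<open>\<open>T\<close> has index three: a proper \<open>A\<close> strictly above it would give
  \<open>4 * card T \<le> 2 * card A \<le> 3 * card T\<close>. This extends properties from
  \<open>T\<close> and one outside element to the whole group.\<close>

lemma subgroup_containing_T:
  assumes A: "subgroup A G" "T \<subseteq> A" and t: "t \<in> A" "t \<notin> T"
  shows "A = carrier G"
proof (rule ccontr)
  assume ne: "A \<noteq> carrier G"
  have sub: "A \<subseteq> carrier G"
    using A(1) by (rule subgroup.subset)
  have "2 * card A \<le> card (carrier G)"
    by (rule G.two_card_proper_subgroup_le[OF A(1) G.subgroup_self sub ne fin])
  moreover have "2 * card T \<le> card A"
    using G.two_card_proper_subgroup_le[OF T_subgroup A(1,2)] t finite_subset[OF sub fin] by blast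
  moreover have "card (carrier G) = 12 * card N"
    using order_eq A.order_12 by (simp add: order_def)
  ultimately show False
    using card_T N_pos by simp
qed

lemma conj_by_T: "\<lbrakk>g \<in> carrier G; v \<in> T\<rbrakk> \<Longrightarrow> conj_by G g v \<in> T"
  using normal.inv_op_closed2[OF A.normal_K, of "h g" "h v"]
  by (simp add: T_def conj_by_def)

lemma kernel_Int_derived: "N \<inter> derived G (carrier G) \<subseteq> {\<one>}"
proof -
  obtain y where y: "y \<in> carrier H" "y \<notin> K"
    using A.exists_outside_K by blast
  then have "y \<in> h ` carrier G"
    using surj by simp
  then obtain t where t: "t \<in> carrier G" "h t \<notin> K"
    using y by blast
  have tT: "t \<notin> T"
    using t by (simp add: T_def)
  have Tc: "v \<in> carrier G" if "v \<in> T" for v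
    using that by (simp add: T_def)
  txt \<open>\<open>f v\<close> is the commutator of \<open>t\<close> and \<open>v\<close>; its image \<open>F\<close> turns out to be normal with abelian quotient.\<close>
  define f where "f v = conj_by G t v \<otimes> inv v" for v
  define F where "F = f ` T"
  have fT: "f v \<in> T" if "v \<in> T" for v
    using that conj_by_T[OF t(1) that] T_subgroup
    by (simp add: f_def subgroup.m_closed subgroup.m_inv_closed)
  then have FT: "F \<subseteq> T"
    by (auto simp: F_def)
  have f_mult: "f (u \<otimes> v) = f u \<otimes> f v" if uv: "u \<in> T" "v \<in> T" for u v
  proof -
    have c: "u \<in> carrier G" "v \<in> carrier G" "f v \<in> carrier G" "f v \<in> T" "inv u \<in> T"
      using uv Tc fT T_subgroup by (auto simp: subgroup.m_inv_closed)
    have "f (u \<otimes> v) = conj_by G t u \<otimes> (f v \<otimes> inv u)"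
      using c t by (simp add: f_def G.conj_by_mult G.inv_mult_group G.m_assoc)
    \<comment> \<open>Both factors lie in the abelian group \<open>T\<close>; this is what makes
      \<open>f\<close> multiplicative.\<close>
    also have "f v \<otimes> inv u = inv u \<otimes> f v"
      using T_commute c by blast
    finally show ?thesis
      using c t by (simp add: f_def G.m_assoc)
  qed
  have f_one: "f \<one> = \<one>"
    using t by (simp add: f_def)
  have F_sub: "subgroup F G"
  proof (rule G.subgroupI)
    show "F \<subseteq> carrier G"
      using FT Tc by blast
    show "F \<noteq> {}"
      using subgroup.one_closed[OF T_subgroup] by (auto simp: F_def)
    show "a \<otimes> b \<in> F" if "a \<in> F" "b \<in> F" for a b
      using that f_mult subgroup.m_closed[OF T_subgroup] by (force simp: F_def)
    show "inv a \<in> F" if a: "a \<in> F" for a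
    proof -
      obtain v where v: "v \<in> T" "a = f v"
        using a by (auto simp: F_def)
      then have iv: "inv v \<in> T"
        using T_subgroup by (simp add: subgroup.m_inv_closed)
      have "f (inv v) \<otimes> f v = \<one>"
        using f_mult[OF iv v(1)] f_one Tc v(1) by simp
      then have "inv a = f (inv v)"
        using v fT iv Tc by (metis G.inv_equality)
      then show ?thesis
        using iv by (simp add: F_def)
    qed
  qed
  \<comment> \<open>If \<open>f v\<close> lies in the kernel, \<open>h v\<close> commutes with
    \<open>h t\<close> and is trivial, as \<open>h t\<close> is outside \<open>K\<close>. Then
    \<open>v\<close> is central and \<open>f v\<close> vanishes.\<close>
  have F_N: "x = \<one>" if xF: "x \<in> F" "x \<in> N" for x
  proof -
    obtain v where v: "v \<in> T" "x = f v"
      using xF by (auto simp: F_def)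
    have vc: "v \<in> carrier G" "h v \<in> K"
      using v by (auto simp: T_def)
    have "conj_by H (h t) (h v) \<otimes>\<^bsub>H\<^esub> inv\<^bsub>H\<^esub> h v = \<one>\<^bsub>H\<^esub>"
      using xF(2) v vc t by (simp add: kernel_def f_def conj_by_def)
    then have "conj_by H (h t) (h v) = h v"
      using vc t by (metis H.conj_by_closed H.inv_closed H.inv_equality H.inv_inv hom_closed)
    then have "h v \<in> centralizer H (h t)"
      using vc t H.conj_by_fixed_iff[of "h t" "h v"] by (simp add: centralizer_def)
    then have "h v = \<one>\<^bsub>H\<^esub>"
      using A.centralizer_Int_K[of "h t" "h v"] vc t by simp
    then have "v \<otimes> t = t \<otimes> v"
      using N_commute[of v t] vc t by (simp add: kernel_def)
    then show ?thesis
      using v vc t G.conj_by_fixed_iff[of t v] by (simp add: f_def)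
  qed
  \<comment> \<open>\<open>?A\<close> is the normalizer of \<open>F\<close>, written with an
    equivalence so that closure under inverses is immediate. Elements of \<open>T\<close> fix
    \<open>F\<close> pointwise, and \<open>t\<close> maps \<open>F\<close> onto itself because
    \<open>f\<close> commutes with conjugation by \<open>t\<close>.\<close>
  have "{g \<in> carrier G. \<forall>x\<in>carrier G. conj_by G g x \<in> F \<longleftrightarrow> x \<in> F} = carrier G" (is "?A = _")
  proof (rule subgroup_containing_T[OF _ _ _ tT])
    show "subgroup ?A G"
    proof (rule G.subgroupI)
      show "?A \<noteq> {}"
        using G.conj_by_one_left by (auto intro!: exI[of _ \<one>])
      show "inv a \<in> ?A" if a: "a \<in> ?A" for a
      proof -
        have ac: "a \<in> carrier G" and aF: "conj_by G a x \<in> F \<longleftrightarrow> x \<in> F" if "x \<in> carrier G" for x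
          using a that by auto
        have "conj_by G (inv a) x \<in> F \<longleftrightarrow> x \<in> F" if x: "x \<in> carrier G" for x
          using aF[of "conj_by G (inv a) x"] ac x by (simp add: G.conj_by_conj_by)
        then show ?thesis using a by simp
      qed
      show "a \<otimes> b \<in> ?A" if "a \<in> ?A" "b \<in> ?A" for a b
        using that by (simp add: G.conj_by_conj_by[symmetric])
    qed auto
    show "T \<subseteq> ?A"
    proof
      fix v assume v: "v \<in> T"
      have fix_T: "conj_by G v x = x" if "x \<in> T" for x
        using that v T_commute[OF v that] Tc by (simp add: G.conj_by_fixed_iff)
      have "conj_by G v x \<in> F \<longleftrightarrow> x \<in> F" if x: "x \<in> carrier G" for x
      proof
        assume cF: "conj_by G v x \<in> F"
        then have "conj_by G v (conj_by G v x) = conj_by G v x"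
          using fix_T FT by blast
        then have "conj_by G v x = x"
          using x v Tc by (simp add: G.conj_by_cancel)
        then show "x \<in> F"
          using cF by simp
      next
        assume "x \<in> F"
        then show "conj_by G v x \<in> F"
          using fix_T FT by (metis subsetD)
      qed
      then show "v \<in> ?A"
        using v Tc by simp
    qed
    have f_conj: "conj_by G t (f v) = f (conj_by G t v)" if "v \<in> T" for v
      using that t Tc by (simp add: f_def G.conj_by_mult G.conj_by_inv)
    have "conj_by G t x \<in> F \<longleftrightarrow> x \<in> F" if x: "x \<in> carrier G" for x
    proof
      assume "conj_by G t x \<in> F"
      then obtain v where v: "v \<in> T" "conj_by G t x = f v"
        by (auto simp: F_def)
      define u where "u = conj_by G (inv t) v"
      have u: "u \<in> T" "conj_by G t u = v"
        using v t Tc conj_by_T by (auto simp: u_def G.conj_by_conj_by)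
      then have "conj_by G t x = conj_by G t (f u)"
        using v f_conj by simp
      then have "x = f u"
        using x t u fT Tc by (metis G.conj_by_cancel)
      then show "x \<in> F"
        using u by (simp add: F_def)
    next
      assume "x \<in> F"
      then show "conj_by G t x \<in> F"
        using f_conj conj_by_T[OF t(1)] by (auto simp: F_def)
    qed
    then show "t \<in> ?A"
      using t by simp
  qed
  then have "conj_by G g x \<in> F" if "g \<in> carrier G" "x \<in> F" for g x
    using that FT Tc by blast
  then have F_normal: "normal F G"
    unfolding G.normal_inv_iff conj_by_def using F_sub by blast
  interpret M: group "G Mod F"
    using F_normal by (rule normal.factorgroup_is_group)
  interpret L: group_hom G "G Mod F" "\<lambda>a. F #> a"
    using normal.r_coset_hom_Mod[OF F_normal]
    by (rule group_hom.intro[OF G.is_group M.is_group group_hom_axioms.intro])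
  have coset_one: "x \<in> F \<longleftrightarrow> F #> x = \<one>\<^bsub>G Mod F\<^esub>" if "x \<in> carrier G" for x
    using G.coset_join1[OF _ that F_sub] G.coset_join2[OF that F_sub] by auto
  \<comment> \<open>The preimage of the centralizer of the coset of \<open>a\<close> modulo
    \<open>F\<close>. It contains \<open>T\<close> and \<open>t\<close>, hence is everything, first
    for \<open>a = t\<close>, then for \<open>a\<close> in \<open>T\<close>, then for all
    \<open>a\<close>; so the quotient by \<open>F\<close> is abelian.\<close>
  define cen where "cen a = {g \<in> carrier G. F #> g \<in> centralizer (G Mod F) (F #> a)}" for a
  have cen_sub: "subgroup (cen a) G" if "a \<in> carrier G" for a
    unfolding cen_def
    by (rule L.vimage_subgroup[OF M.centralizer_subgroup]) (use that in simp)
  have cen_sym: "b \<in> cen a \<Longrightarrow> a \<in> cen b" if "a \<in> carrier G" for a b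
    using that by (simp add: cen_def centralizer_def)
  have cen_comm: "b \<in> cen a" if "a \<in> carrier G" "b \<in> carrier G" "b \<otimes> a = a \<otimes> b" for a b
    using that L.hom_mult[of a b] L.hom_mult[of b a] by (simp add: cen_def centralizer_def del: mult_FactGroup)
  have T_cen_t: "v \<in> cen t" if v: "v \<in> T" for v
  proof -
    have vc: "v \<in> carrier G"
      using v Tc by simp
    have "f v \<in> F" "f v \<in> carrier G"
      using v fT Tc by (auto simp: F_def)
    then have "F #> f v = \<one>\<^bsub>G Mod F\<^esub>"
      using coset_one by blast
    moreover have "t \<otimes> v = f v \<otimes> (v \<otimes> t)"
    proof -
      have "inv v \<otimes> (v \<otimes> t) = t"
        using vc t by (simp add: G.m_assoc[symmetric])
      then show ?thesis
        using vc t by (simp add: f_def conj_by_def G.m_assoc)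
    qed
    ultimately have "F #> (t \<otimes> v) = F #> (v \<otimes> t)"
      using L.hom_mult[of "f v" "v \<otimes> t"] \<open>f v \<in> carrier G\<close> vc t by (simp del: mult_FactGroup one_FactGroup L.hom_mult)
    then have "(F #> t) \<otimes>\<^bsub>G Mod F\<^esub> (F #> v) = (F #> v) \<otimes>\<^bsub>G Mod F\<^esub> (F #> t)"
      using L.hom_mult vc t by metis
    then show ?thesis
      using vc by (simp add: cen_def centralizer_def)
  qed
  have cen_t: "cen t = carrier G"
    by (rule subgroup_containing_T[OF cen_sub[OF t(1)] _ cen_comm[OF t(1) t(1) refl] tT])
      (use T_cen_t in blast)
  have cen_T: "cen v = carrier G" if v: "v \<in> T" for v
  proof (rule subgroup_containing_T[OF cen_sub _ _ tT])
    show "T \<subseteq> cen v"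
      using v Tc T_commute cen_comm by blast
    show "t \<in> cen v"
      using T_cen_t[OF v] cen_sym t by blast
  qed (use v Tc in blast)
  have cen_all: "cen a = carrier G" if a: "a \<in> carrier G" for a
  proof (rule subgroup_containing_T[OF cen_sub[OF a] _ _ tT])
    show "T \<subseteq> cen a"
      using cen_T cen_sym a Tc by blast
    show "t \<in> cen a"
      using cen_t cen_sym a t by blast
  qed
  have "a \<otimes> b \<otimes> inv a \<otimes> inv b \<in> F" if ab: "a \<in> carrier G" "b \<in> carrier G" for a b
  proof -
    have "b \<in> cen a"
      using ab cen_all by simp
    then have "F #> (a \<otimes> b) = F #> (b \<otimes> a)"
      using ab L.hom_mult by (simp add: cen_def centralizer_def del: mult_FactGroup)
    moreover have "F #> (a \<otimes> b \<otimes> inv a \<otimes> inv b) = (F #> (a \<otimes> b)) \<otimes>\<^bsub>G Mod F\<^esub> (F #> inv (b \<otimes> a))"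
      using ab L.hom_mult[of "a \<otimes> b" "inv (b \<otimes> a)"] by (simp add: G.inv_mult_group G.m_assoc)
    moreover have "\<dots> = \<one>\<^bsub>G Mod F\<^esub>" if "F #> (a \<otimes> b) = F #> (b \<otimes> a)"
      unfolding that using ab L.hom_mult[of "b \<otimes> a" "inv (b \<otimes> a)"] L.hom_one by (metis G.m_closed G.r_inv G.inv_closed)
    ultimately show ?thesis
      using coset_one ab by simp
  qed
  then have "derived_set G (carrier G) \<subseteq> F"
    by blast
  then have "derived G (carrier G) \<subseteq> F"
    unfolding derived_def using G.generate_subgroup_incl F_sub by blast
  then show ?thesis
    using F_N by blast
qed

text \<open>The composite of \<open>h\<close> with an isomorphism onto A_4 still has kernel
  \<open>N\<close>, so \<open>isoclinicI\<close> applies once the trivial center of \<open>H\<close>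
  is transported along that isomorphism.\<close>

lemma isoclinic_alt_group_4: "isoclinic G (alt_group 4)"
proof -
  obtain \<rho> where \<rho>: "\<rho> \<in> iso H (alt_group 4)"
    using A.iso_alt_group_4 by blast
  interpret R: group_hom H "alt_group 4" \<rho>
    using \<rho> alt_group_is_group[of 4] H.is_group
    by (auto simp: iso_def intro!: group_hom.intro group_hom_axioms.intro)
  interpret C: group_hom G "alt_group 4" "\<rho> \<circ> h"
    using Group.hom_compose[OF homh R.homh] by (rule group_hom.intro[OF G.is_group R.H.is_group group_hom_axioms.intro])
  have inj: "inj_on \<rho> (carrier H)" and surj4: "\<rho> ` carrier H = carrier (alt_group 4)"
    using \<rho> by (auto simp: iso_def bij_betw_def)
  have ker: "kernel G (alt_group 4) (\<rho> \<circ> h) = N"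
    using inj inj_on_eq_iff[OF inj _ H.one_closed] R.hom_one by (auto simp: kernel_def)
  have cen: "z = \<one>\<^bsub>alt_group 4\<^esub>" if z: "z \<in> group_center (alt_group 4)" for z
  proof -
    have "z \<in> \<rho> ` carrier H"
      using z surj4 by (simp add: group_center_def)
    then obtain q where q: "q \<in> carrier H" "z = \<rho> q"
      by blast
    have "q \<otimes>\<^bsub>H\<^esub> x = x \<otimes>\<^bsub>H\<^esub> q" if x: "x \<in> carrier H" for x
    proof -
      have "\<rho> q \<otimes>\<^bsub>alt_group 4\<^esub> \<rho> x = \<rho> x \<otimes>\<^bsub>alt_group 4\<^esub> \<rho> q"
        using z q x by (simp add: group_center_def)
      then have "\<rho> (q \<otimes>\<^bsub>H\<^esub> x) = \<rho> (x \<otimes>\<^bsub>H\<^esub> q)"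
        using q x by simp
      then show ?thesis
        using inj_onD[OF inj] q x by simp
    qed
    then have "q \<in> group_center H"
      using q by (simp add: group_center_def)
    then show ?thesis
      using A.center_trivial q by simp
  qed
  show ?thesis
  proof (rule C.isoclinicI)
    show "(\<rho> \<circ> h) ` carrier G = carrier (alt_group 4)"
      unfolding image_comp[symmetric] surj surj4 ..
    show "group_center (alt_group 4) = {\<one>\<^bsub>alt_group 4\<^esub>}"
      using cen by (auto simp: group_center_def)
  qed (use ker kernel_central kernel_Int_derived in auto)
qed

end

subsection \<open>Supersolvably embedded normal subgroups\<close>

text \<open>The condition of \<open>supersolvable\<close> with the end of the series left free, so
  that a maximal end can be chosen.\<close>

definition supersolvably_embedded :: "('a, 'b) monoid_scheme \<Rightarrow> 'a set \<Rightarrow> bool" where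
  "supersolvably_embedded G M \<longleftrightarrow>
     (\<exists>(n :: nat) (N :: nat \<Rightarrow> 'a set).
        N 0 = {\<one>\<^bsub>G\<^esub>} \<and> N n = M \<and>
        (\<forall>i \<le> n. N i \<lhd> G) \<and>
        (\<forall>i < n. N i \<subseteq> N (Suc i) \<and> cyclic_group ((G \<lparr> carrier := N (Suc i) \<rparr>) Mod N i)))"

lemma supersolvable_iff: "supersolvable G \<longleftrightarrow> supersolvably_embedded G (carrier G)"
  by (simp add: supersolvable_def supersolvably_embedded_def)

lemma supersolvably_embedded_normal: "supersolvably_embedded G M \<Longrightarrow> M \<lhd> G"
  by (auto simp: supersolvably_embedded_def)

lemma supersolvably_embedded_extend:
  assumes L: "supersolvably_embedded G L" and M: "M \<lhd> G" "L \<subseteq> M"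
    and cyc: "cyclic_group ((G \<lparr> carrier := M \<rparr>) Mod L)"
  shows "supersolvably_embedded G M"
proof -
  from L obtain n and N :: "nat \<Rightarrow> 'a set" where series: "N 0 = {\<one>\<^bsub>G\<^esub>} \<and> N n = L \<and> (\<forall>i \<le> n. N i \<lhd> G) \<and>
      (\<forall>i < n. N i \<subseteq> N (Suc i) \<and> cyclic_group ((G \<lparr> carrier := N (Suc i) \<rparr>) Mod N i))"
    unfolding supersolvably_embedded_def by (elim exE)
  have N: "N 0 = {\<one>\<^bsub>G\<^esub>}" "N n = L" "\<And>i. i \<le> n \<Longrightarrow> N i \<lhd> G"
      "\<And>i. i < n \<Longrightarrow> N i \<subseteq> N (Suc i)"
      "\<And>i. i < n \<Longrightarrow> cyclic_group ((G \<lparr> carrier := N (Suc i) \<rparr>) Mod N i)"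
    using series by simp_all
  define N' where "N' = N(Suc n := M)"
  have "N' i \<subseteq> N' (Suc i) \<and> cyclic_group ((G \<lparr> carrier := N' (Suc i) \<rparr>) Mod N' i)" if "i < Suc n" for i
    using that N(2,4,5) M(2) cyc by (cases "i = n") (auto simp: N'_def)
  moreover have "N' i \<lhd> G" if "i \<le> Suc n" for i
    using that N(3) M(1) by (cases "i = Suc n") (auto simp: N'_def)
  moreover have "N' 0 = {\<one>\<^bsub>G\<^esub>}" "N' (Suc n) = M"
    using N(1) by (simp_all add: N'_def)
  ultimately show ?thesis
    unfolding supersolvably_embedded_def by (intro exI[of _ "Suc n"] exI[of _ N']) simp
qed

lemma (in group) exists_maximal_supersolvably_embedded:
  assumes "finite (carrier G)"
  shows "\<exists>L. supersolvably_embedded G L \<and> (\<forall>M. supersolvably_embedded G M \<longrightarrow> L \<subseteq> M \<longrightarrow> L = M)"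
proof -
  let ?S = "{L. supersolvably_embedded G L}"
  have "?S \<subseteq> Pow (carrier G)"
    using supersolvably_embedded_normal normal_imp_subgroup subgroup.subset by blast
  then have "finite ?S"
    using assms by (simp add: finite_subset)
  moreover have "{\<one>} \<in> ?S"
    using one_is_normal by (auto simp: supersolvably_embedded_def intro!: exI[of _ 0] exI[of _ "\<lambda>_. {\<one>}"])
  ultimately show ?thesis
    using finite_has_maximal[of ?S] by blast
qed

lemma (in normal) r_coset_group_hom: "group_hom G (G Mod H) (\<lambda>a. H #> a)"
  by (rule group_hom.intro[OF is_group factorgroup_is_group group_hom_axioms.intro[OF r_coset_hom_Mod]])

text \<open>The hypothesis speaks of powers in \<open>G Mod H\<close>, while a series needs the
  factor formed inside \<open>M\<close>. The two agree because both are computed on the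
  representative \<open>w\<close>.\<close>

lemma (in normal) cyclic_Mod_of_powers:
  assumes M: "subgroup M G" "H \<subseteq> M" and w: "w \<in> M"
    and pow: "\<And>g. g \<in> M \<Longrightarrow> \<exists>i::int. H #> g = (H #> w) [^]\<^bsub>G Mod H\<^esub> i"
  shows "cyclic_group ((G \<lparr> carrier := M \<rparr>) Mod H)"
proof -
  let ?M = "G \<lparr> carrier := M \<rparr>"
  have wc: "w \<in> carrier G"
    using w subgroup.subset[OF M(1)] by blast
  interpret n: normal H ?M
    using normal_restrict_supergroup[OF M(1) normal_axioms M(2)] .
  interpret Q: group "?M Mod H"
    by (rule n.factorgroup_is_group)
  have carr: "carrier (?M Mod H) = (\<lambda>g. H #> g) ` M"
    by (simp add: carrier_FactGroup)
  have pw: "(H #> w) [^]\<^bsub>?M Mod H\<^esub> (i::int) = H #> (w [^] i)" for i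
    using n.FactGroup_int_pow[of w i] w int_pow_consistent[OF M(1) w, of i] by simp
  have "carrier (?M Mod H) = range (\<lambda>i::int. (H #> w) [^]\<^bsub>?M Mod H\<^esub> i)"
  proof
    show "carrier (?M Mod H) \<subseteq> range (\<lambda>i::int. (H #> w) [^]\<^bsub>?M Mod H\<^esub> i)"
    proof
      fix X assume "X \<in> carrier (?M Mod H)"
      then obtain g where g: "g \<in> M" "X = H #> g"
        using carr by blast
      then obtain i :: int where "H #> g = (H #> w) [^]\<^bsub>G Mod H\<^esub> i"
        using pow by blast
      then have "X = (H #> w) [^]\<^bsub>?M Mod H\<^esub> i"
        using g pw FactGroup_int_pow[OF wc] by simp
      then show "X \<in> range (\<lambda>i::int. (H #> w) [^]\<^bsub>?M Mod H\<^esub> i)"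
        by blast
    qed
    show "range (\<lambda>i::int. (H #> w) [^]\<^bsub>?M Mod H\<^esub> i) \<subseteq> carrier (?M Mod H)"
      using w carr Q.int_pow_closed by blast
  qed
  then show ?thesis
    unfolding Q.cyclic_group using w carr by blast
qed

text \<open>A coset \<open>X\<close> whose only conjugates are \<open>X\<close> and its inverse
  generates a cyclic normal subgroup. Its preimage prolongs the series by one cyclic factor, so it
  equals \<open>L\<close> by maximality and \<open>X\<close> is trivial.\<close>

lemma (in group) no_inversion_stable_quotient:
  assumes fin: "finite (carrier G)" and L: "supersolvably_embedded G L"
    and max: "\<And>M. \<lbrakk>supersolvably_embedded G M; L \<subseteq> M\<rbrakk> \<Longrightarrow> L = M"
  shows "no_inversion_stable (G Mod L)"
proof -
  have nL: "L \<lhd> G"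
    using L by (rule supersolvably_embedded_normal)
  interpret L: normal L G by (rule nL)
  interpret Q: group "G Mod L" by (rule L.factorgroup_is_group)
  interpret P: group_hom G "G Mod L" "\<lambda>a. L #> a" by (rule L.r_coset_group_hom)
  show ?thesis
  proof (rule no_inversion_stable.intro[OF Q.is_group no_inversion_stable_axioms.intro])
    show "finite (carrier (G Mod L))"
      using fin by (simp add: carrier_FactGroup)
    fix X assume X: "X \<in> carrier (G Mod L)"
      and conj: "\<And>Y. Y \<in> carrier (G Mod L) \<Longrightarrow> conj_by (G Mod L) Y X \<in> {X, inv\<^bsub>G Mod L\<^esub> X}"
    obtain w where w: "w \<in> carrier G" "X = L #> w"
      using X by (auto simp: carrier_FactGroup)
    \<comment> \<open>Including the inverse makes the generating set stable under conjugation, as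
      \<open>Q.normal_generateI\<close> demands.\<close>
    define I where "I = generate (G Mod L) {X, inv\<^bsub>G Mod L\<^esub> X}"
    have I_normal: "I \<lhd> (G Mod L)"
      unfolding I_def
    proof (rule Q.normal_generateI)
      fix Z Y assume "Z \<in> {X, inv\<^bsub>G Mod L\<^esub> X}" and Y: "Y \<in> carrier (G Mod L)"
      then have "conj_by (G Mod L) Y Z \<in> {X, inv\<^bsub>G Mod L\<^esub> X}"
        using conj[OF Y] X Q.conj_by_inv[OF Y X] by auto
      then show "Y \<otimes>\<^bsub>G Mod L\<^esub> Z \<otimes>\<^bsub>G Mod L\<^esub> inv\<^bsub>G Mod L\<^esub> Y \<in> {X, inv\<^bsub>G Mod L\<^esub> X}"
        by (simp only: conj_by_def)
    qed (use X in auto)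
    have I_sub: "subgroup I (G Mod L)"
      using I_normal by (rule normal_imp_subgroup)
    have I_pow: "\<exists>i::int. Y = X [^]\<^bsub>G Mod L\<^esub> i" if "Y \<in> I" for Y
    proof -
      have sp: "subgroup (range (\<lambda>i::int. X [^]\<^bsub>G Mod L\<^esub> i)) (G Mod L)"
        using X by (rule Q.subgroup_of_powers)
      have "X = X [^]\<^bsub>G Mod L\<^esub> (1::int)"
        using X by simp
      then have "X \<in> range (\<lambda>i::int. X [^]\<^bsub>G Mod L\<^esub> i)"
        by blast
      then have "{X, inv\<^bsub>G Mod L\<^esub> X} \<subseteq> range (\<lambda>i::int. X [^]\<^bsub>G Mod L\<^esub> i)"
        using subgroup.m_inv_closed[OF sp] by blast
      then have "I \<subseteq> range (\<lambda>i::int. X [^]\<^bsub>G Mod L\<^esub> i)"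
        unfolding I_def by (rule Q.generate_subgroup_incl[OF _ sp])
      then show ?thesis
        using that by blast
    qed
    define M where "M = {g \<in> carrier G. L #> g \<in> I}"
    have M_sub: "subgroup M G"
      unfolding M_def by (rule P.vimage_subgroup[OF I_sub])
    have M_normal: "M \<lhd> G"
      unfolding normal_inv_iff
    proof (intro conjI ballI)
      fix x g assume x: "x \<in> carrier G" and g: "g \<in> M"
      then have gc: "g \<in> carrier G" "L #> g \<in> I"
        by (auto simp: M_def)
      have "L #> (x \<otimes> g \<otimes> inv x) = (L #> x) \<otimes>\<^bsub>G Mod L\<^esub> (L #> g) \<otimes>\<^bsub>G Mod L\<^esub> inv\<^bsub>G Mod L\<^esub> (L #> x)"
        using x gc by (simp del: mult_FactGroup)
      also have "\<dots> \<in> I"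
        using normal.inv_op_closed2[OF I_normal P.hom_closed[OF x] gc(2)] .
      finally show "x \<otimes> g \<otimes> inv x \<in> M"
        using x gc by (simp add: M_def)
    qed (fact M_sub)
    have LM: "L \<subseteq> M"
    proof
      fix g assume g: "g \<in> L"
      then have "L #> g = L"
        using coset_join2[OF _ L.subgroup_axioms g] L.subset by blast
      moreover have "L \<in> I"
        using subgroup.one_closed[OF I_sub] by simp
      ultimately show "g \<in> M"
        using g L.subset by (auto simp: M_def)
    qed
    have wM: "w \<in> M"
      using w generate.incl[of X "{X, inv\<^bsub>G Mod L\<^esub> X}" "G Mod L"] by (simp add: M_def I_def)
    have "cyclic_group ((G \<lparr> carrier := M \<rparr>) Mod L)"
      by (rule L.cyclic_Mod_of_powers[OF M_sub LM wM]) (use I_pow w in \<open>auto simp: M_def\<close>)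
    then have "supersolvably_embedded G M"
      by (rule supersolvably_embedded_extend[OF L M_normal LM])
    then have "w \<in> L"
      using max[OF _ LM] wM by blast
    then show "X = \<one>\<^bsub>G Mod L\<^esub>"
      using w coset_join2[OF w(1) L.subgroup_axioms] by simp
  qed
qed

section \<open>Descent to the quotient by a maximal supersolvably embedded subgroup\<close>

theorem theorem1:
  fixes G :: "('a, 'b) monoid_scheme"
  assumes "group G"
    and "finite (carrier G)"
    and "commuting_probability G > 5 / 16"
  shows "supersolvable G \<or>
         isoclinic G (alt_group 4) \<or>
         isoclinic (G Mod group_center G) (alt_group 4)"
proof (cases "supersolvable G")
  case False
  interpret group G by fact
  have pos: "order G > 0"
    using assms(2) order_gt_0_iff_finite by simp
  have "real (5 * (order G)\<^sup>2) < real (16 * commuting_pairs G)"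
    using assms(3) pos by (simp add: commuting_probability_eq[OF assms(2)] field_simps)
  then have dense: "5 * (order G)\<^sup>2 < 16 * commuting_pairs G"
    using of_nat_less_iff by blast
  obtain L where L: "supersolvably_embedded G L"
    and max: "\<And>M. \<lbrakk>supersolvably_embedded G M; L \<subseteq> M\<rbrakk> \<Longrightarrow> L = M"
    using exists_maximal_supersolvably_embedded[OF assms(2)] by blast
  interpret L: normal L G
    using L by (rule supersolvably_embedded_normal)
  interpret Q: no_inversion_stable "G Mod L"
    using assms(2) L max by (rule no_inversion_stable_quotient)
  interpret P: finite_epi G "G Mod L" "\<lambda>a. L #>\<^bsub>G\<^esub> a"
    by (rule finite_epi.intro[OF L.r_coset_group_hom finite_epi_axioms.intro[OF assms(2)]])
      (simp add: carrier_FactGroup)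
  have "L \<noteq> carrier G"
    using L False by (auto simp: supersolvable_iff)
  then have nontriv: "order (G Mod L) \<noteq> 1"
    using L.fact_group_trivial_iff[OF assms(2)] Q.order_one_triv_iff by simp
  \<comment> \<open>From the quotient to \<open>G\<close>, the squared order grows exactly by the
    factor \<open>k\<close> and the number of commuting pairs at most by it, so the density
    inequality descends after cancelling \<open>k\<close>.\<close>
  define k where "k = (card P.N)\<^sup>2"
  have "5 * (k * (order (G Mod L))\<^sup>2) < 16 * commuting_pairs G"
    using dense by (simp add: P.order_eq power_mult_distrib k_def)
  also have "\<dots> \<le> 16 * (k * commuting_pairs (G Mod L))"
    using P.commuting_pairs_le by (simp add: k_def)
  finally have "k * (5 * (order (G Mod L))\<^sup>2) < k * (16 * commuting_pairs (G Mod L))"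
    by (simp add: mult.left_commute)
  then have "5 * (order (G Mod L))\<^sup>2 < 16 * commuting_pairs (G Mod L)"
    by simp
  then obtain K where K: "a4_like (G Mod L) K"
    using Q.a4_like_of_commuting_pairs nontriv by blast
  have "a4_quotient G (G Mod L) (\<lambda>a. L #>\<^bsub>G\<^esub> a) K"
    by (rule a4_quotient.intro[OF P.finite_epi_axioms K a4_quotient_axioms.intro[OF dense]])
  then show ?thesis
    using a4_quotient.isoclinic_alt_group_4 by blast
qed simp

end
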